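(* Let $M=G/H$ be a naturally reductive homogeneous space. The symmetric bilinear forms $A$ and $\beta$ on $\mathfrak m$ satisfy, for all $X,Y\in\mathfrak m$, $$A(X,Y)=\sum_iQ_{\mathfrak h}([X,Z_i],[Y,Z_i]),\qquad \beta(X,Y)=\sum_i\langle[X,Z_i]_{\mathfrak m},[Y,Z_i]_{\mathfrak m}\rangle+2A(X,Y).$$ Thus, for every $t\in\mathbb R$, the Ricci tensor of $\nabla^t$ is given by $$\mathrm{Ric}^t(X,Y)=(t-t^2)\,\beta(X,Y)+(2t^2-2t+1)\,A(X,Y).$$
   Context: Setting. $M=G/H$ is a Riemannian homogeneous space, reductive: $\mathfrak g=\mathfrak h\oplus\mathfrak m$ with $\mathrm{Ad}(H)\mathfrak m\subset\mathfrak m$; $\mathfrak m$ is identified with the tangent space at the base point and $\langle\,,\rangle$ is the inner product on $\mathfrak m$ induced by the metric. Subscripts $\mathfrak m,\mathfrak h$ denote components in $\mathfrak g=\mathfrak h\oplus\mathfrak m$. The metric is naturally reductive: $\langle[X,Y]_{\mathfrak m},Z\rangle+\langle Y,[X,Z]_{\mathfrak m}\rangle=0$ for all $X,Y,Z\in\mathfrak m$. It is assumed that $\mathfrak g=\mathfrak m+[\mathfrak m,\mathfrak m]$, and $Q$ denotes the $\mathrm{Ad}(G)$-invariant, symmetric, non-degenerate bilinear form on $\mathfrak g$ (not necessarily positive definite) with $Q(\mathfrak h,\mathfrak m)=0$ and $Q|_{\mathfrak m}=\langle\,,\rangle$; $Q_{\mathfrak h}(A,B)=Q(A_{\mathfrak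 h},B_{\mathfrak h})$ for $A,B\in\mathfrak g$. $Z_1,\dots,Z_n$ is an orthonormal basis of $\mathfrak m$. $\nabla^t$ is the $G$-invariant metric connection $\nabla^t_XY=\nabla^0_XY+t[X,Y]_{\mathfrak m}$, where $\nabla^0$ is the canonical connection; its curvature at the base point is $R^t(X,Y)=[\Lambda^t(X),\Lambda^t(Y)]-\Lambda^t([X,Y]_{\mathfrak m})-\mathrm{ad}([X,Y]_{\mathfrak h})$ with $\Lambda^t(X)Y=t[X,Y]_{\mathfrak m}$, and $\mathrm{Ric}^t(X,Y)=\sum_i\langle R^t(X,Z_i)Z_i,Y\rangle$. $C_{\mathfrak h}=-\sum_i\mathrm{ad}X_i\,\mathrm{ad}Y_i$ is the Casimir operator of $\mathfrak h$ acting on $\mathfrak g$, where $X_i,Y_i$ are bases of $\mathfrak h$ with $Q(X_i,Y_j)=\delta_{ij}$. For $X,Y\in\mathfrak m$: $A(X,Y)=\langle C_{\mathfrak h}X,Y\rangle$ and $\beta(X,Y)=-\mathrm{tr}_{\mathfrak g}(\mathrm{ad}X\,\mathrm{ad}Y)$. *)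

theory Defs
  imports "HOL-Analysis.Analysis" "HOL-Algebra.Group"
begin

section \<open>Smooth maps\<close>

text \<open>
  Intended for open sets. On an open set of a Euclidean space, \<open>Ck_on k\<close> is the usual class of
  \<open>k\<close> times continuously differentiable maps: all iterated directional derivatives up to order
  \<open>k\<close> exist as Frechet derivatives of the preceding ones and are continuous.
\<close>

primrec Ck_on ::
  "nat \<Rightarrow> 'a::real_normed_vector set \<Rightarrow> ('a \<Rightarrow> 'b::real_normed_vector) \<Rightarrow> bool" where
  "Ck_on 0 S = (\<lambda>f. continuous_on S f)"
| "Ck_on (Suc k) S = (\<lambda>f. (\<forall>x\<in>S. f differentiable (at x)) \<and>
      (\<forall>v. Ck_on k S (\<lambda>x. frechet_derivative f (at x) v)))"

definition smooth_on :: "'a::real_normed_vector set \<Rightarrow> ('a \<Rightarrow> 'b::real_normed_vector) \<Rightarrow> bool"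
  where "smooth_on S f \<longleftrightarrow> (\<forall>k. Ck_on k S f)"


section \<open>Lie groups\<close>

type_synonym ('a, 'd) chart = "'a set \<times> ('a \<Rightarrow> real ^ 'd)"

text \<open>
  A smooth manifold is a second countable Hausdorff space with an atlas \<open>\<A>\<close> of smoothly compatible
  charts \<open>(U, \<phi>)\<close>; the atlas need not be maximal. The inverse of the chart is \<open>inv_into U \<phi>\<close>.
\<close>

locale lie_group = group G for G :: "('a, 'b) monoid_scheme" (structure) +
  fixes T :: "'a topology" and \<A> :: "('a, 'd::finite) chart set"
  assumes topspace_eq: "topspace T = carrier G"
    and hausdorff: "Hausdorff_space T"
    and countable: "second_countable T"
    and atlas_cover: "(\<Union>(U, \<phi>)\<in>\<A>. U) = carrier G"
    and chart_domain: "\<And>U \<phi>. (U, \<phi>) \<in> \<A> \<Longrightarrow> openin T U"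
    and chart_range: "\<And>U \<phi>. (U, \<phi>) \<in> \<A> \<Longrightarrow> open (\<phi> ` U)"
    and chart_homeo: "\<And>U \<phi>. (U, \<phi>) \<in> \<A> \<Longrightarrow>
      homeomorphic_map (subtopology T U) (top_of_set (\<phi> ` U)) \<phi>"
    and chart_compat: "\<And>U \<phi> V \<psi>. (U, \<phi>) \<in> \<A> \<Longrightarrow> (V, \<psi>) \<in> \<A> \<Longrightarrow>
      smooth_on (\<phi> ` (U \<inter> V)) (\<lambda>p. \<psi> (inv_into U \<phi> p))"
    and continuous_mult: "continuous_map (prod_topology T T) T (\<lambda>(x, y). x \<otimes> y)"
    and continuous_inv: "continuous_map T T (\<lambda>x. inv x)"
    and smooth_mult: "\<And>U \<phi> V \<psi> W \<theta>. (U, \<phi>) \<in> \<A> \<Longrightarrow> (V, \<psi>) \<in> \<A> \<Longrightarrow> (W, \<theta>) \<in> \<A> \<Longrightarrow>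
      smooth_on {(\<phi> x, \<psi> y) | x y. x \<in> U \<and> y \<in> V \<and> x \<otimes> y \<in> W}
        (\<lambda>(p, q). \<theta> (inv_into U \<phi> p \<otimes> inv_into V \<psi> q))"
    and smooth_inv: "\<And>U \<phi> V \<psi>. (U, \<phi>) \<in> \<A> \<Longrightarrow> (V, \<psi>) \<in> \<A> \<Longrightarrow>
      smooth_on {\<phi> x | x. x \<in> U \<and> inv x \<in> V} (\<lambda>p. \<psi> (inv (inv_into U \<phi> p)))"

text \<open>
  Below, \<open>(U, \<phi>)\<close> is a chart around the identity. It identifies the tangent space of \<open>G\<close> at the
  identity, that is, the Lie algebra of \<open>G\<close>, with \<open>real ^ 'd\<close>.

  In this chart, the left-invariant vector field with value \<open>X\<close> at the identity has at \<open>p\<close> the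
  value given by the differential of the left translation by \<open>\<phi>\<^sup>-\<^sup>1 p\<close>, applied to \<open>X\<close>. The bracket
  of \<open>X\<close> and \<open>Y\<close> is the value at the identity of the commutator of the two left-invariant fields;
  in coordinates the commutator of \<open>V\<close> and \<open>W\<close> is \<open>DW V - DV W\<close>.
\<close>

definition left_invariant_field ::
  "('a, 'b) monoid_scheme \<Rightarrow> ('a, 'd::finite) chart \<Rightarrow> real ^ 'd \<Rightarrow> real ^ 'd \<Rightarrow> real ^ 'd" where
  "left_invariant_field G = (\<lambda>(U, \<phi>) X p.
     frechet_derivative (\<lambda>q. \<phi> (inv_into U \<phi> p \<otimes>\<^bsub>G\<^esub> inv_into U \<phi> q)) (at (\<phi> \<one>\<^bsub>G\<^esub>)) X)"

definition lie_bracket ::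
  "('a, 'b) monoid_scheme \<Rightarrow> ('a, 'd::finite) chart \<Rightarrow> real ^ 'd \<Rightarrow> real ^ 'd \<Rightarrow> real ^ 'd" where
  "lie_bracket G c X Y =
     frechet_derivative (left_invariant_field G c Y) (at (snd c \<one>\<^bsub>G\<^esub>)) X
     - frechet_derivative (left_invariant_field G c X) (at (snd c \<one>\<^bsub>G\<^esub>)) Y"

definition Ad ::
  "('a, 'b) monoid_scheme \<Rightarrow> ('a, 'd::finite) chart \<Rightarrow> 'a \<Rightarrow> real ^ 'd \<Rightarrow> real ^ 'd" where
  "Ad G = (\<lambda>(U, \<phi>) g.
     frechet_derivative (\<lambda>q. \<phi> (g \<otimes>\<^bsub>G\<^esub> inv_into U \<phi> q \<otimes>\<^bsub>G\<^esub> inv\<^bsub>G\<^esub> g)) (at (\<phi> \<one>\<^bsub>G\<^esub>)))"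

text \<open>
  The Lie algebra of a closed subgroup \<open>H\<close>, as a subset of that of \<open>G\<close>: the velocities at the
  identity of the smooth curves of \<open>G\<close> that lie in \<open>H\<close>.
\<close>

definition subgroup_lie_algebra ::
  "('a, 'b) monoid_scheme \<Rightarrow> ('a, 'd::finite) chart \<Rightarrow> 'a set \<Rightarrow> (real ^ 'd) set" where
  "subgroup_lie_algebra G = (\<lambda>(U, \<phi>) H. {X. \<exists>\<epsilon>>0. \<exists>\<gamma> :: real \<Rightarrow> 'a.
     \<gamma> 0 = \<one>\<^bsub>G\<^esub> \<and> (\<forall>t\<in>{-\<epsilon><..<\<epsilon>}. \<gamma> t \<in> H \<inter> U) \<and>
     smooth_on {-\<epsilon><..<\<epsilon>} (\<lambda>t. \<phi> (\<gamma> t)) \<and>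
     ((\<lambda>t. \<phi> (\<gamma> t)) has_vector_derivative X) (at 0)})"


section \<open>Linear algebra\<close>

text \<open>The component in \<open>V\<close> of a vector, with respect to a direct sum decomposition into \<open>V\<close> and \<open>W\<close>.\<close>

definition component :: "'v::real_vector set \<Rightarrow> 'v set \<Rightarrow> 'v \<Rightarrow> 'v" where
  "component V W X = (THE v. v \<in> V \<and> X - v \<in> W)"

definition direct_sum :: "'v::real_vector set \<Rightarrow> 'v set \<Rightarrow> bool" where
  "direct_sum V W \<longleftrightarrow> V \<inter> W = {0} \<and> (\<forall>X. \<exists>v\<in>V. \<exists>w\<in>W. X = v + w)"

definition symmetric_bilinear_on :: "'v::real_vector set \<Rightarrow> ('v \<Rightarrow> 'v \<Rightarrow> real) \<Rightarrow> bool" where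
  "symmetric_bilinear_on S B \<longleftrightarrow>
     (\<forall>X\<in>S. \<forall>Y\<in>S. B X Y = B Y X) \<and>
     (\<forall>X\<in>S. \<forall>Y\<in>S. \<forall>Z\<in>S. \<forall>a b. B (a *\<^sub>R X + b *\<^sub>R Y) Z = a * B X Z + b * B Y Z)"

definition inner_product_on :: "'v::real_vector set \<Rightarrow> ('v \<Rightarrow> 'v \<Rightarrow> real) \<Rightarrow> bool" where
  "inner_product_on S B \<longleftrightarrow> symmetric_bilinear_on S B \<and> (\<forall>X\<in>S. X \<noteq> 0 \<longrightarrow> B X X > 0)"

definition nondegenerate :: "('v::real_vector \<Rightarrow> 'v \<Rightarrow> real) \<Rightarrow> bool" where
  "nondegenerate B \<longleftrightarrow> (\<forall>X. (\<forall>Y. B X Y = 0) \<longrightarrow> X = 0)"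

definition basis_of :: "'v::real_vector set \<Rightarrow> nat \<Rightarrow> (nat \<Rightarrow> 'v) \<Rightarrow> bool" where
  "basis_of S n E \<longleftrightarrow>
     inj_on E {1..n} \<and> independent (E ` {1..n}) \<and> span (E ` {1..n}) = S"

definition orthonormal_basis_of ::
  "'v::real_vector set \<Rightarrow> ('v \<Rightarrow> 'v \<Rightarrow> real) \<Rightarrow> nat \<Rightarrow> (nat \<Rightarrow> 'v) \<Rightarrow> bool" where
  "orthonormal_basis_of S B n E \<longleftrightarrow> basis_of S n E \<and>
     (\<forall>i\<in>{1..n}. \<forall>j\<in>{1..n}. B (E i) (E j) = (if i = j then 1 else 0))"

definition dual_bases_of ::
  "'v::real_vector set \<Rightarrow> ('v \<Rightarrow> 'v \<Rightarrow> real) \<Rightarrow> nat \<Rightarrow> (nat \<Rightarrow> 'v) \<Rightarrow> (nat \<Rightarrow> 'v) \<Rightarrow> bool" where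
  "dual_bases_of S B k E F \<longleftrightarrow> basis_of S k E \<and> basis_of S k F \<and>
     (\<forall>i\<in>{1..k}. \<forall>j\<in>{1..k}. B (E i) (F j) = (if i = j then 1 else 0))"


section \<open>Naturally reductive homogeneous spaces\<close>

text \<open>
  A Riemannian homogeneous space \<open>G/H\<close> with a reductive decomposition of the Lie algebra: the
  tangent space at the base point is \<open>\<mm>\<close>, and a \<open>G\<close>-invariant Riemannian metric is given by its
  value at the base point, an \<open>Ad(H)\<close>-invariant inner product on \<open>\<mm>\<close>. The values of \<open>ip\<close> outside
  of \<open>\<mm>\<close> are irrelevant.
\<close>

locale reductive_homogeneous_space = lie_group G T \<A>
  for G :: "('a, 'b) monoid_scheme" (structure) and T and \<A> :: "('a, 'd::finite) chart set" +
  fixes c :: "('a, 'd) chart" and H :: "'a set"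
    and \<mm> :: "(real ^ 'd) set" and ip :: "real ^ 'd \<Rightarrow> real ^ 'd \<Rightarrow> real"
  assumes chart: "c \<in> \<A>" "\<one> \<in> fst c"
    and closed_subgroup: "subgroup H G" "closedin T H"
    and subspace_m: "subspace \<mm>"
    and decomposition: "direct_sum (subgroup_lie_algebra G c H) \<mm>"
    and Ad_m: "\<And>g X. g \<in> H \<Longrightarrow> X \<in> \<mm> \<Longrightarrow> Ad G c g X \<in> \<mm>"
    and inner_product: "inner_product_on \<mm> ip"
    and invariant_metric: "\<And>g X Y. g \<in> H \<Longrightarrow> X \<in> \<mm> \<Longrightarrow> Y \<in> \<mm> \<Longrightarrow>
      ip (Ad G c g X) (Ad G c g Y) = ip X Y"

text \<open>\<open>Q\<close> is determined by the conditions below, because of \<open>spanning\<close>.\<close>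

locale naturally_reductive_space = reductive_homogeneous_space G T \<A> c H \<mm> ip
  for G :: "('a, 'b) monoid_scheme" (structure) and T and \<A> :: "('a, 'd::finite) chart set"
    and c and H and \<mm> and ip +
  fixes Q :: "real ^ 'd \<Rightarrow> real ^ 'd \<Rightarrow> real"
  assumes naturally_reductive: "\<And>X Y Z. X \<in> \<mm> \<Longrightarrow> Y \<in> \<mm> \<Longrightarrow> Z \<in> \<mm> \<Longrightarrow>
      ip (component \<mm> (subgroup_lie_algebra G c H) (lie_bracket G c X Y)) Z
      + ip Y (component \<mm> (subgroup_lie_algebra G c H) (lie_bracket G c X Z)) = 0"
    and spanning: "\<And>V. \<exists>X\<in>\<mm>. \<exists>W\<in>span {lie_bracket G c Y Z | Y Z. Y \<in> \<mm> \<and> Z \<in> \<mm>}. V = X + W"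
    and Q_form: "symmetric_bilinear_on UNIV Q" "nondegenerate Q"
    and Q_invariant: "\<And>g X Y. g \<in> carrier G \<Longrightarrow> Q (Ad G c g X) (Ad G c g Y) = Q X Y"
    and Q_orthogonal: "\<And>X Y. X \<in> subgroup_lie_algebra G c H \<Longrightarrow> Y \<in> \<mm> \<Longrightarrow> Q X Y = 0"
    and Q_m: "\<And>X Y. X \<in> \<mm> \<Longrightarrow> Y \<in> \<mm> \<Longrightarrow> Q X Y = ip X Y"


section \<open>Curvature and Casimir operator\<close>

text \<open>
  In the following, \<open>br\<close> is the Lie bracket, and \<open>\<hh>\<close> and \<open>\<mm>\<close> are the two summands of the reductive
  decomposition. \<open>curv\<close> is the curvature at the base point of the connection \<open>\<nabla>\<^sup>t\<close>, which adds \<open>t\<close>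
  times the \<open>\<mm>\<close>-component of the bracket to the canonical connection.
\<close>

type_synonym 'v bracket = "'v \<Rightarrow> 'v \<Rightarrow> 'v"

definition Lam ::
  "'v::real_vector bracket \<Rightarrow> 'v set \<Rightarrow> 'v set \<Rightarrow> real \<Rightarrow> 'v \<Rightarrow> 'v \<Rightarrow> 'v" where
  "Lam br \<hh> \<mm> t X Y = t *\<^sub>R component \<mm> \<hh> (br X Y)"

definition curv ::
  "'v::real_vector bracket \<Rightarrow> 'v set \<Rightarrow> 'v set \<Rightarrow> real \<Rightarrow> 'v \<Rightarrow> 'v \<Rightarrow> 'v \<Rightarrow> 'v" where
  "curv br \<hh> \<mm> t X Y Z =
     (Lam br \<hh> \<mm> t X (Lam br \<hh> \<mm> t Y Z) - Lam br \<hh> \<mm> t Y (Lam br \<hh> \<mm> t X Z))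
     - Lam br \<hh> \<mm> t (component \<mm> \<hh> (br X Y)) Z
     - br (component \<hh> \<mm> (br X Y)) Z"

definition Ric ::
  "'v::real_vector bracket \<Rightarrow> 'v set \<Rightarrow> 'v set \<Rightarrow> ('v \<Rightarrow> 'v \<Rightarrow> real) \<Rightarrow> nat \<Rightarrow> (nat \<Rightarrow> 'v)
     \<Rightarrow> real \<Rightarrow> 'v \<Rightarrow> 'v \<Rightarrow> real" where
  "Ric br \<hh> \<mm> ip n Z t X Y = (\<Sum>i=1..n. ip (curv br \<hh> \<mm> t X (Z i) (Z i)) Y)"

definition casimir ::
  "'v::real_vector bracket \<Rightarrow> nat \<Rightarrow> (nat \<Rightarrow> 'v) \<Rightarrow> (nat \<Rightarrow> 'v) \<Rightarrow> 'v \<Rightarrow> 'v" where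
  "casimir br k E F V = - (\<Sum>i=1..k. br (E i) (br (F i) V))"

definition A_form ::
  "'v::real_vector bracket \<Rightarrow> ('v \<Rightarrow> 'v \<Rightarrow> real) \<Rightarrow> nat \<Rightarrow> (nat \<Rightarrow> 'v) \<Rightarrow> (nat \<Rightarrow> 'v)
     \<Rightarrow> 'v \<Rightarrow> 'v \<Rightarrow> real" where
  "A_form br ip k E F X Y = ip (casimir br k E F X) Y"

definition beta_form :: "(real ^ 'd::finite) bracket \<Rightarrow> real ^ 'd \<Rightarrow> real ^ 'd \<Rightarrow> real" where
  "beta_form br X Y = - trace (matrix (\<lambda>V. br X (br Y V)))"

definition Q_part ::
  "'v::real_vector set \<Rightarrow> 'v set \<Rightarrow> ('v \<Rightarrow> 'v \<Rightarrow> real) \<Rightarrow> 'v \<Rightarrow> 'v \<Rightarrow> real" where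
  "Q_part \<hh> \<mm> Q V W = Q (component \<hh> \<mm> V) (component \<hh> \<mm> W)"

end

theory Submission
  imports Defs
begin

text \<open>
  In a chart around the identity let \<open>\<mu>\<close> be the multiplication. With \<open>x = \<phi>\<^sup>-\<^sup>1 p\<close>, the identity
  \<open>x y = (x y x\<^sup>-\<^sup>1) x\<close> gives \<open>\<partial>\<^sub>1\<mu>(e, p) (Ad x Y) = \<partial>\<^sub>2\<mu>(p, e) Y\<close>. Differentiating in \<open>p\<close> and using
  the symmetry of the second derivative of \<open>\<mu>\<close> yields \<open>d Ad(X) Y = [X, Y]\<close>. Hence \<open>Q\<close> is
  \<open>ad\<close>-invariant and \<open>[\<hh>, \<mm>] \<subseteq> \<mm>\<close>. The rest is linear algebra: all traces are expanded in the
  orthonormal basis of \<open>\<mm>\<close> and the dual bases of \<open>\<hh>\<close>, and brackets are moved by invariance of \<open>Q\<close>.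
\<close>

section \<open>Symmetry of mixed second derivatives\<close>

text \<open>Mean value inequality in the direction \<open>u\<close>, with the increment
  \<open>s *\<^sub>R v\<close> frozen. The difference of \<open>f' x u\<close> at the two ends of
  that increment is \<open>s *\<^sub>R G v\<close> up to an error small relative to
  \<open>s\<close>, because \<open>f' x u\<close> is differentiable in \<open>x\<close> at
  \<open>a\<close>; integrating over a length \<open>s\<close> gives the factor
  \<open>s\<^sup>2\<close>.\<close>

lemma second_difference_bound:
  fixes f :: "'a::real_normed_vector \<Rightarrow> 'b::real_normed_vector"
  assumes S: "open S" "a \<in> S" and f: "\<And>x. x \<in> S \<Longrightarrow> (f has_derivative f' x) (at x)"
    and G: "((\<lambda>x. f' x u) has_derivative G) (at a)" and e: "e > 0"
  shows "\<forall>\<^sub>F s in at_right 0. norm (f (a + s *\<^sub>R u + s *\<^sub>R v) - f (a + s *\<^sub>R u) - f (a + s *\<^sub>R v) + f a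
    - s\<^sup>2 *\<^sub>R G v) \<le> e * s\<^sup>2"
proof -
  \<comment> \<open>\<open>s * M\<close> bounds \<open>r *\<^sub>R u + q *\<^sub>R v\<close> for all
    \<open>r\<close> and \<open>q\<close> between 0 and \<open>s\<close>; the summand 1 keeps
    \<open>M\<close> positive when \<open>u\<close> and \<open>v\<close> vanish.\<close>
  define M where "M = norm u + norm v + 1"
  have M: "M > 0"
    by (simp add: M_def add_nonneg_pos)
  interpret G: bounded_linear G
    using G has_derivative_bounded_linear by blast
  \<comment> \<open>The constant is chosen so that two errors of this kind at distance at most
    \<open>s * M\<close> add up to \<open>e * s\<close>.\<close>
  obtain d1 where d1: "d1 > 0" "\<And>y. norm (y - a) < d1 \<Longrightarrow>
      norm (f' y u - f' a u - G (y - a)) \<le> e / (2 * M) * norm (y - a)"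
    using G[unfolded has_derivative_at_alt] e M by (metis divide_pos_pos mult_pos_pos zero_less_numeral)
  obtain d2 where d2: "d2 > 0" "ball a d2 \<subseteq> S"
    using S openE by blast
  define d where "d = min d1 d2 / M"
  have "d > 0"
    using d1 d2 M by (simp add: d_def)
  moreover have "norm (f (a + s *\<^sub>R u + s *\<^sub>R v) - f (a + s *\<^sub>R u) - f (a + s *\<^sub>R v) + f a
      - s\<^sup>2 *\<^sub>R G v) \<le> e * s\<^sup>2" if s: "0 < s" "s < d" for s
  proof -
    have near: "norm (r *\<^sub>R u + q *\<^sub>R v) \<le> s * M" "a + r *\<^sub>R u + q *\<^sub>R v \<in> S"
      "norm (r *\<^sub>R u + q *\<^sub>R v) < d1" if "r \<in> {0..s}" "q \<in> {0..s}" for r q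
    proof -
      have "norm (r *\<^sub>R u + q *\<^sub>R v) \<le> r * norm u + q * norm v"
        using that by (metis abs_of_nonneg atLeastAtMost_iff norm_scaleR norm_triangle_ineq)
      also have "\<dots> \<le> s * norm u + s * norm v"
        using that by (intro add_mono mult_right_mono) auto
      also have "\<dots> \<le> s * M"
        using s by (simp add: M_def algebra_simps)
      finally show *: "norm (r *\<^sub>R u + q *\<^sub>R v) \<le> s * M" .
      moreover have "s * M < min d1 d2"
        using s M by (simp add: d_def field_simps)
      ultimately have lt: "norm (r *\<^sub>R u + q *\<^sub>R v) < d1" "norm (r *\<^sub>R u + q *\<^sub>R v) < d2"
        by linarith+
      then have "a + (r *\<^sub>R u + q *\<^sub>R v) \<in> ball a d2"
        by (simp only: mem_ball dist_norm add_diff_cancel_left' norm_minus_commute[of a])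
      then show "norm (r *\<^sub>R u + q *\<^sub>R v) < d1" "a + r *\<^sub>R u + q *\<^sub>R v \<in> S"
        using d2(2) lt by (auto simp only: add.assoc)
    qed
    \<comment> \<open>\<open>?w\<close> is the derivative of \<open>?\<psi>\<close>, and
      \<open>?\<psi> s - ?\<psi> 0\<close> is exactly the second difference minus
      \<open>s\<^sup>2 *\<^sub>R G v\<close>.\<close>
    let ?w = "\<lambda>r. f' (a + r *\<^sub>R u + s *\<^sub>R v) u - f' (a + r *\<^sub>R u) u - s *\<^sub>R G v"
    let ?\<psi> = "\<lambda>r. f (a + r *\<^sub>R u + s *\<^sub>R v) - f (a + r *\<^sub>R u) - r *\<^sub>R s *\<^sub>R G v"
    have "norm (?\<psi> s - ?\<psi> 0) \<le> e * s * norm (s - 0)"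
    proof (rule differentiable_bound[of "{0..s}"])
      fix r assume r: "r \<in> {0..s}"
      have lin: "linear (f' x)" if "x \<in> S" for x
        using f[OF that] has_derivative_linear by blast
      have 1: "((\<lambda>r. f (a + r *\<^sub>R u + q *\<^sub>R v)) has_derivative (\<lambda>h. h *\<^sub>R f' (a + r *\<^sub>R u + q *\<^sub>R v) u))
          (at r within {0..s})" if "q \<in> {0..s}" for q
      proof -
        have "((\<lambda>r. f (a + r *\<^sub>R u + q *\<^sub>R v)) has_derivative (\<lambda>h. f' (a + r *\<^sub>R u + q *\<^sub>R v) (h *\<^sub>R u)))
          (at r within {0..s})"
          by (rule has_derivative_compose[where f = "\<lambda>r. a + r *\<^sub>R u + q *\<^sub>R v", OF _ f[OF near(2)[OF r that]]])
            (auto intro!: derivative_eq_intros)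
        then show ?thesis
          using linear_scale[OF lin[OF near(2)[OF r that]]] by simp
      qed
      have "(?\<psi> has_derivative (\<lambda>h. h *\<^sub>R f' (a + r *\<^sub>R u + s *\<^sub>R v) u - h *\<^sub>R f' (a + r *\<^sub>R u) u
          - h *\<^sub>R s *\<^sub>R G v)) (at r within {0..s})"
        using 1[of s] 1[of 0] s by (auto intro!: derivative_eq_intros)
      then show "(?\<psi> has_derivative (\<lambda>h. h *\<^sub>R ?w r)) (at r within {0..s})"
        by (simp add: scaleR_diff_right)
      \<comment> \<open>Both values of the derivative are compared with the linearization at
        \<open>a\<close>; the two linear terms differ by \<open>s *\<^sub>R G v\<close>.\<close>
      have "norm (?w r) = norm ((f' (a + r *\<^sub>R u + s *\<^sub>R v) u - f' a u - G (r *\<^sub>R u + s *\<^sub>R v))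
          - (f' (a + r *\<^sub>R u) u - f' a u - G (r *\<^sub>R u)))"
        by (simp add: G.add G.scaleR algebra_simps)
      also have "\<dots> \<le> norm (f' (a + r *\<^sub>R u + s *\<^sub>R v) u - f' a u - G (r *\<^sub>R u + s *\<^sub>R v))
          + norm (f' (a + r *\<^sub>R u) u - f' a u - G (r *\<^sub>R u))"
        by (rule norm_triangle_ineq4)
      also have "\<dots> \<le> e / (2 * M) * (s * M) + e / (2 * M) * (s * M)"
      proof (rule add_mono)
        have *: "norm (f' (a + r *\<^sub>R u + q *\<^sub>R v) u - f' a u - G (r *\<^sub>R u + q *\<^sub>R v)) \<le> e / (2 * M) * (s * M)"
          if q: "q \<in> {0..s}" for q
        proof -
          have eq: "a + r *\<^sub>R u + q *\<^sub>R v - a = r *\<^sub>R u + q *\<^sub>R v"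
            by simp
          have "norm (f' (a + r *\<^sub>R u + q *\<^sub>R v) u - f' a u - G (r *\<^sub>R u + q *\<^sub>R v))
              \<le> e / (2 * M) * norm (r *\<^sub>R u + q *\<^sub>R v)"
            using d1(2)[of "a + r *\<^sub>R u + q *\<^sub>R v", unfolded eq, OF near(3)[OF r q]] .
          also have "\<dots> \<le> e / (2 * M) * (s * M)"
            using near(1)[OF r q] e M by (intro mult_left_mono) auto
          finally show ?thesis .
        qed
        show "norm (f' (a + r *\<^sub>R u + s *\<^sub>R v) u - f' a u - G (r *\<^sub>R u + s *\<^sub>R v)) \<le> e / (2 * M) * (s * M)"
          using *[of s] s by simp
        show "norm (f' (a + r *\<^sub>R u) u - f' a u - G (r *\<^sub>R u)) \<le> e / (2 * M) * (s * M)"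
          using *[of 0] s by simp
      qed
      also have "\<dots> = e * s"
        using M by (simp add: field_simps)
      finally show "onorm (\<lambda>h. h *\<^sub>R ?w r) \<le> e * s"
        using onorm_scaleR_left[OF bounded_linear_ident, of "?w r"] by (simp add: onorm_id)
    qed (use s in auto)
    then show ?thesis
      using s by (simp add: power2_eq_square algebra_simps)
  qed
  ultimately show ?thesis
    using eventually_at_right_field by blast
qed

text \<open>The second difference is symmetric in \<open>u\<close> and \<open>v\<close>, so
  \<open>s\<^sup>2 *\<^sub>R G v\<close> and \<open>s\<^sup>2 *\<^sub>R H u\<close> approximate the
  same vector \<open>P\<close> with error at most \<open>e/2 * s\<^sup>2\<close> each. Dividing by
  \<open>s\<^sup>2\<close> leaves a distance of at most \<open>e\<close>.\<close>

lemma has_derivative_mixed_symmetric: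
  fixes f :: "'a::real_normed_vector \<Rightarrow> 'b::real_normed_vector"
  assumes S: "open S" "a \<in> S" and f: "\<And>x. x \<in> S \<Longrightarrow> (f has_derivative f' x) (at x)"
    and G: "((\<lambda>x. f' x u) has_derivative G) (at a)"
    and H: "((\<lambda>x. f' x v) has_derivative H) (at a)"
  shows "G v = H u"
proof -
  have "norm (G v - H u) \<le> 0 + e" if e: "e > 0" for e
  proof -
    have "\<forall>\<^sub>F s in at_right 0. s > 0 \<and>
      norm (f (a + s *\<^sub>R u + s *\<^sub>R v) - f (a + s *\<^sub>R u) - f (a + s *\<^sub>R v) + f a - s\<^sup>2 *\<^sub>R G v) \<le> e/2 * s\<^sup>2 \<and>
      norm (f (a + s *\<^sub>R v + s *\<^sub>R u) - f (a + s *\<^sub>R v) - f (a + s *\<^sub>R u) + f a - s\<^sup>2 *\<^sub>R H u) \<le> e/2 * s\<^sup>2"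
      using e second_difference_bound[OF S f G, of "e/2" v] second_difference_bound[OF S f H, of "e/2" u]
      by (intro eventually_conj eventually_at_right_less) auto
    then obtain s where s: "s > 0"
      "norm (f (a + s *\<^sub>R u + s *\<^sub>R v) - f (a + s *\<^sub>R u) - f (a + s *\<^sub>R v) + f a - s\<^sup>2 *\<^sub>R G v) \<le> e/2 * s\<^sup>2"
      "norm (f (a + s *\<^sub>R v + s *\<^sub>R u) - f (a + s *\<^sub>R v) - f (a + s *\<^sub>R u) + f a - s\<^sup>2 *\<^sub>R H u) \<le> e/2 * s\<^sup>2"
      using eventually_happens'[OF trivial_limit_at_right_real] by blast
    define P where "P = f (a + s *\<^sub>R u + s *\<^sub>R v) - f (a + s *\<^sub>R u) - f (a + s *\<^sub>R v) + f a"
    have "a + s *\<^sub>R v + s *\<^sub>R u = a + s *\<^sub>R u + s *\<^sub>R v"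
      by (rule add.commute[of "s *\<^sub>R v", THEN arg_cong[where f = "(+) a"], folded add.assoc])
    moreover have "x - y - z + w = x - z - y + w" for x y z w :: 'b
      by simp
    ultimately have "f (a + s *\<^sub>R v + s *\<^sub>R u) - f (a + s *\<^sub>R v) - f (a + s *\<^sub>R u) + f a = P"
      unfolding P_def by presburger
    then have "norm (P - s\<^sup>2 *\<^sub>R G v) \<le> e/2 * s\<^sup>2" "norm (P - s\<^sup>2 *\<^sub>R H u) \<le> e/2 * s\<^sup>2"
      using s(2,3) by (simp_all only: P_def)
    then have "norm ((P - s\<^sup>2 *\<^sub>R H u) - (P - s\<^sup>2 *\<^sub>R G v)) \<le> e/2 * s\<^sup>2 + e/2 * s\<^sup>2"
      by (metis add.commute add_mono norm_triangle_ineq4 order_trans)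
    then have "s\<^sup>2 * norm (G v - H u) \<le> s\<^sup>2 * e"
      by (simp add: mult.commute flip: scaleR_diff_right)
    then show ?thesis
      using s(1) by simp
  qed
  then have "norm (G v - H u) \<le> 0"
    by (rule field_le_epsilon)
  then show ?thesis
    by simp
qed

section \<open>Calculus of curves and smooth maps\<close>

lemma has_vector_derivative_at_0_iff:
  "(f has_vector_derivative f') (at 0) \<longleftrightarrow> ((\<lambda>t. (f t - f 0) /\<^sub>R t) \<longlongrightarrow> f') (at 0)"
proof -
  have "(f has_vector_derivative f') (at 0)
      \<longleftrightarrow> ((\<lambda>t. norm (f t - f 0 - t *\<^sub>R f') / norm t) \<longlongrightarrow> 0) (at 0)"
    by (simp add: has_vector_derivative_def has_derivative_iff_norm bounded_linear_scaleR_left)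
  also have "\<dots> \<longleftrightarrow> ((\<lambda>t. norm ((f t - f 0) /\<^sub>R t - f')) \<longlongrightarrow> 0) (at 0)"
  proof (rule tendsto_cong)
    have "norm (f t - f 0 - t *\<^sub>R f') / norm t = norm ((f t - f 0) /\<^sub>R t - f')" if "t \<noteq> 0" for t
    proof -
      have "(f t - f 0) /\<^sub>R t - f' = (f t - f 0 - t *\<^sub>R f') /\<^sub>R t"
        using that by (simp add: scaleR_diff_right)
      then show ?thesis
        by (simp add: divide_inverse mult.commute)
    qed
    then show "\<forall>\<^sub>F t in at 0. norm (f t - f 0 - t *\<^sub>R f') / norm t = norm ((f t - f 0) /\<^sub>R t - f')"
      by (auto simp: eventually_at_filter)
  qed
  also have "\<dots> \<longleftrightarrow> ((\<lambda>t. (f t - f 0) /\<^sub>R t) \<longlongrightarrow> f') (at 0)"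
    by (simp add: tendsto_norm_zero_iff LIM_zero_iff)
  finally show ?thesis .
qed

text \<open>Product rule for \<open>R t (a t) = l t\<close>, solved for the derivative of
  \<open>a\<close>, whose differentiability is part of the conclusion. First \<open>a\<close> is
  shown to tend to \<open>l 0\<close>; then its difference quotient is expressed through those of
  \<open>l\<close> and of \<open>R t b\<close> for basis vectors \<open>b\<close>.\<close>

lemma has_vector_derivative_solve_linear:
  fixes R :: "real \<Rightarrow> 'a::euclidean_space \<Rightarrow> 'a"
  assumes lin: "\<forall>\<^sub>F t in at 0. linear (R t)" and R0: "\<And>V. R 0 V = V"
    and dR: "\<And>V. ((\<lambda>t. R t V) has_vector_derivative R' V) (at 0)" and R': "linear R'"
    and dl: "(l has_vector_derivative l') (at 0)"
    and eq: "\<forall>\<^sub>F t in at 0. R t (a t) = l t" and a0: "a 0 = l 0"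
  shows "(a has_vector_derivative l' - R' (l 0)) (at 0)"
proof -
  \<comment> \<open>A bound for the operator norm of \<open>R t\<close> minus the identity, computed
    on the basis so that pointwise differentiability of \<open>R\<close> makes it tend to 0.\<close>
  define \<delta> where "\<delta> t = (\<Sum>b\<in>Basis. norm (R t b - b))" for t
  have split: "R t V - V = (\<Sum>b\<in>Basis. (V \<bullet> b) *\<^sub>R (R t b - b))" if "linear (R t)" for t V
  proof -
    have "R t V - V = R t (\<Sum>b\<in>Basis. (V \<bullet> b) *\<^sub>R b) - (\<Sum>b\<in>Basis. (V \<bullet> b) *\<^sub>R b)"
      by (simp add: euclidean_representation)
    also have "\<dots> = (\<Sum>b\<in>Basis. (V \<bullet> b) *\<^sub>R (R t b - b))"
      using that by (simp add: linear_sum linear_scale scaleR_diff_right sum_subtractf)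
    finally show ?thesis .
  qed
  have bound: "norm (R t V - V) \<le> norm V * \<delta> t" if "linear (R t)" for t V
  proof -
    have "norm (R t V - V) \<le> (\<Sum>b\<in>Basis. norm ((V \<bullet> b) *\<^sub>R (R t b - b)))"
      by (subst split[OF that]) (rule norm_sum)
    also have "\<dots> \<le> (\<Sum>b\<in>Basis. norm V * norm (R t b - b))"
      by (intro sum_mono) (simp add: Basis_le_norm mult_right_mono)
    finally show ?thesis
      by (simp add: \<delta>_def sum_distrib_left)
  qed
  have tend: "((\<lambda>t. f t) \<longlongrightarrow> f 0) (at 0)" if "(f has_vector_derivative f') (at 0)"
    for f :: "real \<Rightarrow> 'a" and f'
    using has_vector_derivative_continuous[OF that] by (simp add: continuous_at)
  have \<delta>: "(\<delta> \<longlongrightarrow> 0) (at 0)"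
  proof -
    have "((\<lambda>t. \<Sum>b\<in>Basis. norm (R t b - b)) \<longlongrightarrow> (\<Sum>b\<in>(Basis::'a set). norm (b - b))) (at 0)"
      by (intro tendsto_sum tendsto_norm tendsto_diff tendsto_const) (metis tend[OF dR] R0)
    then show ?thesis
      by (simp add: \<delta>_def[abs_def])
  qed
  have "((\<lambda>t. a t - l t) \<longlongrightarrow> 0) (at 0)"
  proof (rule Lim_null_comparison)
    \<comment> \<open>Below 1/2, the error \<open>norm (a t) * \<delta> t\<close> can be absorbed:
      it yields \<open>norm (a t) \<le> 2 * norm (l t)\<close>, so \<open>a\<close> stays bounded by
      \<open>l\<close>.\<close>
    have "\<forall>\<^sub>F t in at 0. \<delta> t < 1/2"
      using \<delta> by (rule order_tendstoD) simp
    then show "\<forall>\<^sub>F t in at 0. norm (a t - l t) \<le> 2 * norm (l t) * \<delta> t"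
      using lin eq
    proof eventually_elim
      case (elim t)
      have *: "norm (a t - l t) \<le> norm (a t) * \<delta> t"
        using bound[OF elim(2), of "a t"] elim(3) by (simp add: norm_minus_commute)
      have "0 \<le> \<delta> t"
        by (simp add: \<delta>_def sum_nonneg)
      have "norm (a t) * \<delta> t \<le> norm (a t) * (1/2)"
        using elim(1) by (intro mult_left_mono) auto
      then have "norm (a t) \<le> 2 * norm (l t)"
        using * norm_triangle_sub[of "a t" "l t"] by linarith
      then have "norm (a t) * \<delta> t \<le> 2 * norm (l t) * \<delta> t"
        using \<open>0 \<le> \<delta> t\<close> by (rule mult_right_mono)
      with * show ?case
        by linarith
    qed
    show "((\<lambda>t. 2 * norm (l t) * \<delta> t) \<longlongrightarrow> 0) (at 0)"
      using tend[OF dl] \<delta> by (auto intro!: tendsto_eq_intros)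
  qed
  from tendsto_add[OF this tend[OF dl]] have a_lim: "(a \<longlongrightarrow> l 0) (at 0)"
    by simp
  \<comment> \<open>The expression agrees with the difference quotient of \<open>a\<close> near 0,
    since the sum equals \<open>(l t - a t) /\<^sub>R t\<close>.\<close>
  have "((\<lambda>t. (l t - l 0) /\<^sub>R t - (\<Sum>b\<in>Basis. (a t \<bullet> b) *\<^sub>R ((R t b - R 0 b) /\<^sub>R t)))
      \<longlongrightarrow> l' - (\<Sum>b\<in>Basis. (l 0 \<bullet> b) *\<^sub>R R' b)) (at 0)"
    using dl dR a_lim
    by (intro tendsto_intros) (auto simp: has_vector_derivative_at_0_iff)
  moreover have "(\<Sum>b\<in>Basis. (l 0 \<bullet> b) *\<^sub>R R' b) = R' (l 0)"
    by (metis (mono_tags, lifting) R' euclidean_representation linear_scale linear_sum sum.cong)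
  moreover have "\<forall>\<^sub>F t in at 0. (l t - l 0) /\<^sub>R t - (\<Sum>b\<in>Basis. (a t \<bullet> b) *\<^sub>R ((R t b - R 0 b) /\<^sub>R t))
      = (a t - a 0) /\<^sub>R t"
    using lin eq
  proof eventually_elim
    case (elim t)
    have "(\<Sum>b\<in>Basis. (a t \<bullet> b) *\<^sub>R ((R t b - R 0 b) /\<^sub>R t)) = (l t - a t) /\<^sub>R t"
      using split[OF elim(1), of "a t"] elim(2)
      by (simp add: R0 scaleR_sum_right mult.commute)
    then show ?case
      by (simp add: a0 flip: scaleR_diff_right)
  qed
  ultimately show ?thesis
    unfolding has_vector_derivative_at_0_iff by (simp add: tendsto_cong)
qed

lemma smooth_onD:
  assumes "smooth_on S f" "x \<in> S"
  shows "(f has_derivative frechet_derivative f (at x)) (at x)"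
    and "((\<lambda>y. frechet_derivative f (at y) v) has_derivative
      frechet_derivative (\<lambda>y. frechet_derivative f (at y) v) (at x)) (at x)"
proof -
  have "Ck_on (Suc (Suc 0)) S f"
    using assms unfolding smooth_on_def by blast
  with assms(2) show "(f has_derivative frechet_derivative f (at x)) (at x)"
    and "((\<lambda>y. frechet_derivative f (at y) v) has_derivative
      frechet_derivative (\<lambda>y. frechet_derivative f (at y) v) (at x)) (at x)"
    by (auto simp: frechet_derivative_works[symmetric])
qed

lemma differentiable_transform_open:
  assumes "f differentiable (at x)" "open S" "x \<in> S" "\<And>y. y \<in> S \<Longrightarrow> f y = h y"
  shows "h differentiable (at x)"
  using assms unfolding differentiable_def
  by (blast intro: has_derivative_transform_within_open)

section \<open>Multiplication of a Lie group in a chart around the identity\<close>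

locale lie_group_chart = lie_group G T \<A>
  for G :: "('a, 'b) monoid_scheme" (structure) and T and \<A> :: "('a, 'd::finite) chart set" +
  fixes U :: "'a set" and \<phi> :: "'a \<Rightarrow> real ^ 'd"
  assumes chart_in_atlas: "(U, \<phi>) \<in> \<A>" and one_in_U: "\<one> \<in> U"
begin

abbreviation \<psi> :: "real ^ 'd \<Rightarrow> 'a" where "\<psi> \<equiv> inv_into U \<phi>"
abbreviation e :: "real ^ 'd" where "e \<equiv> \<phi> \<one>"

definition \<mu> :: "(real ^ 'd) \<times> (real ^ 'd) \<Rightarrow> real ^ 'd" where
  "\<mu> = (\<lambda>(p, q). \<phi> (\<psi> p \<otimes> \<psi> q))"

definition D\<mu> :: "(real ^ 'd) \<times> (real ^ 'd) \<Rightarrow> (real ^ 'd) \<times> (real ^ 'd) \<Rightarrow> real ^ 'd" where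
  "D\<mu> z = frechet_derivative \<mu> (at z)"

text \<open>The second derivative of \<open>\<mu>\<close> at the identity: \<open>v\<close> is the
  direction of the first differentiation, the remaining argument that of the second.\<close>

definition D2\<mu> :: "(real ^ 'd) \<times> (real ^ 'd) \<Rightarrow> (real ^ 'd) \<times> (real ^ 'd) \<Rightarrow> real ^ 'd" where
  "D2\<mu> v = frechet_derivative (\<lambda>z. D\<mu> z v) (at (e, e))"

lemma U_carrier: "U \<subseteq> carrier G"
  using openin_subset[OF chart_domain[OF chart_in_atlas]] topspace_eq by simp

lemma chart_inj:
  assumes "(V, \<theta>) \<in> \<A>"
  shows "inj_on \<theta> V"
  using homeomorphic_imp_injective_map[OF chart_homeo[OF assms]] openin_subset[OF chart_domain[OF assms]]
  by (simp add: Int_absorb1)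

lemma psi_phi: "x \<in> U \<Longrightarrow> \<psi> (\<phi> x) = x"
  using chart_inj[OF chart_in_atlas] by simp

lemma phi_psi: "p \<in> \<phi> ` U \<Longrightarrow> \<phi> (\<psi> p) = p"
  by (rule f_inv_into_f)

lemma psi_in: "p \<in> \<phi> ` U \<Longrightarrow> \<psi> p \<in> U"
  by (rule inv_into_into)

lemma open_chart_range: "open (\<phi> ` U)"
  by (rule chart_range[OF chart_in_atlas])

lemma e_in: "e \<in> \<phi> ` U"
  using one_in_U by simp

lemma open_chart_image:
  assumes "openin T W" "W \<subseteq> U"
  shows "open (\<phi> ` W)"
proof -
  have "openin (subtopology T U) W"
    unfolding openin_subtopology using assms by blast
  then have "openin (top_of_set (\<phi> ` U)) (\<phi> ` W)"
    using homeomorphic_imp_open_map[OF chart_homeo[OF chart_in_atlas]] by (simp add: open_map_def)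
  then show ?thesis
    using open_chart_range openin_open_eq by blast
qed

lemma smooth_mu: "smooth_on {(\<phi> x, \<phi> y) | x y. x \<in> U \<and> y \<in> U \<and> x \<otimes> y \<in> U} \<mu>"
  unfolding \<mu>_def by (rule smooth_mult[OF chart_in_atlas chart_in_atlas chart_in_atlas])

lemma mu_has_derivative:
  assumes "x \<in> U" "y \<in> U" "x \<otimes> y \<in> U"
  shows "(\<mu> has_derivative D\<mu> (\<phi> x, \<phi> y)) (at (\<phi> x, \<phi> y))"
  unfolding D\<mu>_def by (rule smooth_onD(1)[OF smooth_mu]) (use assms in blast)

lemma linear_Dmu:
  assumes "x \<in> U" "y \<in> U" "x \<otimes> y \<in> U"
  shows "linear (D\<mu> (\<phi> x, \<phi> y))"
  using mu_has_derivative[OF assms] by (rule has_derivative_linear)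

lemma Dmu_has_derivative: "((\<lambda>z. D\<mu> z v) has_derivative D2\<mu> v) (at (e, e))"
  unfolding D\<mu>_def D2\<mu>_def
  by (rule smooth_onD(2)[OF smooth_mu]) (use one_in_U in \<open>force intro: exI[of _ \<one>]\<close>)

lemma linear_D2mu: "linear (D2\<mu> v)"
  using Dmu_has_derivative by (rule has_derivative_linear)

lemma mu_eq: "x \<in> U \<Longrightarrow> y \<in> U \<Longrightarrow> \<mu> (\<phi> x, \<phi> y) = \<phi> (x \<otimes> y)"
  by (simp add: \<mu>_def psi_phi)

lemma mu_left_has_derivative:
  assumes "x \<in> U"
  shows "((\<lambda>p. \<mu> (p, \<phi> x)) has_derivative (\<lambda>X. D\<mu> (e, \<phi> x) (X, 0))) (at e)"
  by (rule has_derivative_compose[where f = "\<lambda>p. (p, \<phi> x)", OF _ mu_has_derivative])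
    (use assms one_in_U U_carrier in \<open>auto intro!: derivative_eq_intros\<close>)

lemma mu_right_has_derivative:
  assumes "x \<in> U"
  shows "((\<lambda>q. \<mu> (\<phi> x, q)) has_derivative (\<lambda>X. D\<mu> (\<phi> x, e) (0, X))) (at e)"
  by (rule has_derivative_compose[where f = "\<lambda>q. (\<phi> x, q)", OF _ mu_has_derivative])
    (use assms one_in_U U_carrier in \<open>auto intro!: derivative_eq_intros\<close>)

text \<open>Multiplication by the identity on either side is the identity map in the chart.\<close>

lemma Dmu_one: "D\<mu> (e, e) (X, 0) = X" "D\<mu> (e, e) (0, X) = X"
proof -
  have "\<mu> (p, e) = p" "\<mu> (e, p) = p" if "p \<in> \<phi> ` U" for p
    using that one_in_U U_carrier by (auto simp: mu_eq)
  then have "((\<lambda>p. p) has_derivative (\<lambda>X. D\<mu> (e, e) (X, 0))) (at e)"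
    and "((\<lambda>p. p) has_derivative (\<lambda>X. D\<mu> (e, e) (0, X))) (at e)"
    using has_derivative_transform_within_open[OF mu_left_has_derivative[OF one_in_U] open_chart_range e_in, of "\<lambda>p. p"]
      has_derivative_transform_within_open[OF mu_right_has_derivative[OF one_in_U] open_chart_range e_in, of "\<lambda>p. p"]
    by auto
  then show "D\<mu> (e, e) (X, 0) = X" "D\<mu> (e, e) (0, X) = X"
    using has_derivative_unique[OF has_derivative_ident] by metis+
qed

lemma left_invariant_field_eq:
  assumes "p \<in> \<phi> ` U"
  shows "left_invariant_field G (U, \<phi>) X p = D\<mu> (p, e) (0, X)"
proof -
  have "((\<lambda>q. \<phi> (\<psi> p \<otimes> \<psi> q)) has_derivative (\<lambda>X. D\<mu> (p, e) (0, X))) (at e)"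
    using mu_right_has_derivative[OF psi_in[OF assms]] phi_psi[OF assms] by (simp add: \<mu>_def)
  from frechet_derivative_at[OF this, symmetric] show ?thesis
    by (simp add: left_invariant_field_def)
qed

text \<open>Chain rule along \<open>p \<mapsto> (p, e)\<close>: on the chart range the field is
  \<open>D\<mu> (p, e) (0, Y)\<close>, and only the first slot of the base point moves.\<close>

lemma left_invariant_field_has_derivative:
  "(left_invariant_field G (U, \<phi>) Y has_derivative (\<lambda>X. D2\<mu> (0, Y) (X, 0))) (at e)"
proof -
  have "((\<lambda>p. D\<mu> (p, e) (0, Y)) has_derivative (\<lambda>X. D2\<mu> (0, Y) (X, 0))) (at e)"
    by (rule has_derivative_compose[where f = "\<lambda>p. (p, e)", OF _ Dmu_has_derivative])
      (auto intro!: derivative_eq_intros)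
  then show ?thesis
    by (rule has_derivative_transform_within_open[OF _ open_chart_range e_in])
      (simp add: left_invariant_field_eq)
qed

lemma lie_bracket_eq: "lie_bracket G (U, \<phi>) X Y = D2\<mu> (0, Y) (X, 0) - D2\<mu> (0, X) (Y, 0)"
  unfolding lie_bracket_def
  by (simp flip: frechet_derivative_at[OF left_invariant_field_has_derivative])

lemma lie_bracket_anticommute: "lie_bracket G (U, \<phi>) X Y = - lie_bracket G (U, \<phi>) Y X"
  by (simp add: lie_bracket_def)

text \<open>Here the direction of the first differentiation varies. Linearity holds for
  \<open>D\<mu> (p, e)\<close> at every \<open>p\<close> in the chart range and passes to the
  derivative in \<open>p\<close> by uniqueness of derivatives.\<close>

lemma linear_D2mu_direction: "linear (\<lambda>Y. D2\<mu> (0, Y) (X, 0))"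
proof -
  have lin: "D\<mu> (p, e) (0, a *\<^sub>R Y + b *\<^sub>R Z) = a *\<^sub>R D\<mu> (p, e) (0, Y) + b *\<^sub>R D\<mu> (p, e) (0, Z)"
    if p: "p \<in> \<phi> ` U" for p a b Y Z
  proof -
    have D: "linear (D\<mu> (p, e))"
      using p linear_Dmu[OF _ one_in_U] U_carrier by auto
    show ?thesis
      using linear_add[OF D, of "a *\<^sub>R (0, Y)" "b *\<^sub>R (0, Z)"]
        linear_scale[OF D, of a "(0, Y)"] linear_scale[OF D, of b "(0, Z)"] by simp
  qed
  have "D2\<mu> (0, a *\<^sub>R Y + b *\<^sub>R Z) (X, 0) = a *\<^sub>R D2\<mu> (0, Y) (X, 0) + b *\<^sub>R D2\<mu> (0, Z) (X, 0)" for a b Y Z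
  proof -
    let ?L = "left_invariant_field G (U, \<phi>)"
    have "((\<lambda>p. a *\<^sub>R ?L Y p + b *\<^sub>R ?L Z p) has_derivative
        (\<lambda>X. a *\<^sub>R D2\<mu> (0, Y) (X, 0) + b *\<^sub>R D2\<mu> (0, Z) (X, 0))) (at e)"
      by (intro has_derivative_add has_derivative_scaleR_right left_invariant_field_has_derivative)
    then have "(?L (a *\<^sub>R Y + b *\<^sub>R Z) has_derivative
        (\<lambda>X. a *\<^sub>R D2\<mu> (0, Y) (X, 0) + b *\<^sub>R D2\<mu> (0, Z) (X, 0))) (at e)"
      by (rule has_derivative_transform_within_open[OF _ open_chart_range e_in])
        (simp add: left_invariant_field_eq lin)
    from has_derivative_unique[OF left_invariant_field_has_derivative this] show ?thesis
      by meson
  qed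
  from this[of 1 _ 1] this[of _ _ 0] show ?thesis
    by (intro linearI) simp_all
qed

lemma bilinear_lie_bracket: "bilinear (lie_bracket G (U, \<phi>))"
proof -
  have "linear (\<lambda>X. D2\<mu> (0, Y) (X, 0))" for Y
    using left_invariant_field_has_derivative by (rule has_derivative_linear)
  then show ?thesis
    unfolding bilinear_def lie_bracket_eq by (intro conjI allI linear_compose_sub linear_D2mu_direction)
qed

lemma continuous_map_mult:
  assumes "continuous_map T T f" "continuous_map T T g"
  shows "continuous_map T T (\<lambda>x. f x \<otimes> g x)"
  using continuous_map_compose[OF continuous_map_pairedI[OF assms] continuous_mult] by (simp add: o_def)

text \<open>Continuity of the multiplication provides a product neighbourhood of
  \<open>(\<one>, \<one>)\<close> that is mapped into \<open>U\<close>; on its image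
  \<open>\<mu>\<close> is differentiable, so symmetry of mixed derivatives applies at
  \<open>(e, e)\<close>.\<close>

lemma D2mu_symmetric: "D2\<mu> (X, 0) (0, Y) = D2\<mu> (0, Y) (X, 0)"
proof -
  let ?W = "{z \<in> topspace (prod_topology T T). (\<lambda>(x, y). x \<otimes> y) z \<in> U}"
  have "openin (prod_topology T T) ?W"
    by (rule openin_continuous_map_preimage[OF continuous_mult chart_domain[OF chart_in_atlas]])
  moreover have "(\<one>, \<one>) \<in> ?W"
    using one_in_U by (simp add: topspace_eq)
  ultimately obtain O1 O2 where O: "openin T O1" "openin T O2" "\<one> \<in> O1" "\<one> \<in> O2" "O1 \<times> O2 \<subseteq> ?W"
    unfolding openin_prod_topology_alt by meson
  let ?N = "(\<phi> ` (O1 \<inter> U)) \<times> (\<phi> ` (O2 \<inter> U))"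
  have "open ?N"
    using O chart_domain[OF chart_in_atlas] by (intro open_Times open_chart_image openin_Int) auto
  moreover have "(e, e) \<in> ?N"
    using O one_in_U by auto
  moreover have "(\<mu> has_derivative D\<mu> z) (at z)" if "z \<in> ?N" for z
    using that O(5) mu_has_derivative by fastforce
  ultimately show ?thesis
    by (rule has_derivative_mixed_symmetric[where f' = D\<mu>, OF _ _ _ Dmu_has_derivative Dmu_has_derivative])
qed

section \<open>Conjugation and the adjoint representation near the identity\<close>

context
  fixes g assumes g: "g \<in> U"
begin

text \<open>The intermediate condition \<open>g \<otimes> x \<in> U\<close> lets conjugation be
  computed as left multiplication within the chart followed by right multiplication.\<close>

abbreviation "conj_domain \<equiv> {x \<in> U. g \<otimes> x \<in> U \<and> g \<otimes> x \<otimes> inv g \<in> U}"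

lemma open_conj_domain: "open (\<phi> ` conj_domain)"
proof (rule open_chart_image)
  have 1: "continuous_map T T (\<lambda>x. g \<otimes> x)"
    using g U_carrier by (intro continuous_map_mult) (auto simp: topspace_eq)
  then have 2: "continuous_map T T (\<lambda>x. g \<otimes> x \<otimes> inv g)"
    using g U_carrier by (intro continuous_map_mult) (auto simp: topspace_eq)
  have "openin T {x \<in> {x \<in> U. g \<otimes> x \<in> U}. g \<otimes> x \<otimes> inv g \<in> U}"
    by (intro openin_continuous_map_preimage_gen[OF 1] openin_continuous_map_preimage_gen[OF 2]
        chart_domain[OF chart_in_atlas])
  then show "openin T conj_domain"
    by (simp add: conj_assoc)
qed auto

lemma e_in_conj_domain: "e \<in> \<phi> ` conj_domain"
  using g one_in_U U_carrier by auto

text \<open>\<open>Ad\<close> is defined as a \<open>frechet_derivative\<close>, so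
  differentiability of conjugation has to be established. It is the composition of left
  multiplication by \<open>g\<close> with right multiplication by \<open>inv g\<close>.\<close>

lemma Ad_has_derivative:
  "((\<lambda>q. \<phi> (g \<otimes> \<psi> q \<otimes> inv g)) has_derivative Ad G (U, \<phi>) g) (at e)"
proof -
  have gG: "g \<in> carrier G"
    using g U_carrier by auto
  \<comment> \<open>The chart domain \<open>U\<close> need not contain \<open>inv g\<close>, so the
    right factor is read in another chart; the product \<open>g \<otimes> inv g\<close> lies in
    \<open>U\<close> again.\<close>
  then obtain V \<theta> where V: "(V, \<theta>) \<in> \<A>" "inv g \<in> V"
    using atlas_cover by fastforce
  let ?\<nu> = "\<lambda>(p, q). \<phi> (\<psi> p \<otimes> inv_into V \<theta> q)"
  have "?\<nu> differentiable (at (\<phi> g, \<theta> (inv g)))"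
  proof -
    have "smooth_on {(\<phi> x, \<theta> y) |x y. x \<in> U \<and> y \<in> V \<and> x \<otimes> y \<in> U} ?\<nu>"
      by (rule smooth_mult[OF chart_in_atlas V(1) chart_in_atlas])
    moreover have "(\<phi> g, \<theta> (inv g)) \<in> {(\<phi> x, \<theta> y) |x y. x \<in> U \<and> y \<in> V \<and> x \<otimes> y \<in> U}"
      using g V(2) one_in_U r_inv[OF gG] by force
    ultimately show ?thesis
      by (rule differentiableI[OF smooth_onD(1)])
  qed
  moreover have "(\<lambda>q. (\<mu> (\<phi> g, q), \<theta> (inv g))) differentiable (at e)"
    by (rule differentiableI[OF has_derivative_Pair[OF mu_right_has_derivative[OF g] has_derivative_const]])
  moreover have "\<mu> (\<phi> g, e) = \<phi> g"
    using g one_in_U gG by (simp add: mu_eq)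
  ultimately have "(\<lambda>q. ?\<nu> (\<mu> (\<phi> g, q), \<theta> (inv g))) differentiable (at e)"
    using differentiable_compose[of ?\<nu> "\<lambda>q. (\<mu> (\<phi> g, q), \<theta> (inv g))" e UNIV] by simp
  moreover have "?\<nu> (\<mu> (\<phi> g, q), \<theta> (inv g)) = \<phi> (g \<otimes> \<psi> q \<otimes> inv g)" if "q \<in> \<phi> ` conj_domain" for q
    using that g V chart_inj[OF V(1)] by (auto simp: mu_eq psi_phi)
  ultimately have "(\<lambda>q. \<phi> (g \<otimes> \<psi> q \<otimes> inv g)) differentiable (at e)"
    by (rule differentiable_transform_open[OF _ open_conj_domain e_in_conj_domain])
  then show ?thesis
    by (simp add: Ad_def frechet_derivative_works[symmetric])
qed

text \<open>The derivative at \<open>q = e\<close> of \<open>g x = (g x g\<^sup>-\<^sup>1) g\<close> with \<open>q = \<phi> x\<close>.\<close>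

lemma Dmu_Ad: "D\<mu> (e, \<phi> g) (Ad G (U, \<phi>) g Y, 0) = D\<mu> (\<phi> g, e) (0, Y)"
proof -
  let ?c = "\<lambda>q. \<phi> (g \<otimes> \<psi> q \<otimes> inv g)"
  have gG: "g \<in> carrier G"
    using g U_carrier by auto
  have ce: "?c e = e"
    using gG one_in_U by (simp add: psi_phi)
  have "((\<lambda>q. \<mu> (?c q, \<phi> g)) has_derivative (\<lambda>Y. D\<mu> (e, \<phi> g) (Ad G (U, \<phi>) g Y, 0))) (at e)"
    by (rule has_derivative_compose[where f = ?c and g = "\<lambda>p. \<mu> (p, \<phi> g)", OF Ad_has_derivative])
      (use mu_left_has_derivative[OF g] ce in simp)
  moreover have "\<mu> (?c q, \<phi> g) = \<mu> (\<phi> g, q)" if q: "q \<in> \<phi> ` conj_domain" for q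
  proof -
    obtain x where x: "x \<in> U" "g \<otimes> x \<in> U" "g \<otimes> x \<otimes> inv g \<in> U" "q = \<phi> x"
      using q by blast
    then have "g \<otimes> x \<otimes> inv g \<otimes> g = g \<otimes> x"
      using gG U_carrier by (simp add: m_assoc subset_iff)
    then show ?thesis
      using x g by (simp add: mu_eq psi_phi)
  qed
  ultimately have "((\<lambda>q. \<mu> (\<phi> g, q)) has_derivative (\<lambda>Y. D\<mu> (e, \<phi> g) (Ad G (U, \<phi>) g Y, 0))) (at e)"
    by (rule has_derivative_transform_within_open[OF _ open_conj_domain e_in_conj_domain])
  from has_derivative_unique[OF this mu_right_has_derivative[OF g]] show ?thesis
    by meson
qed

end

lemma Ad_one: "Ad G (U, \<phi>) \<one> Y = Y"
  using Dmu_Ad[OF one_in_U, of Y] by (simp add: Dmu_one)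

text \<open>At \<open>g = \<gamma> t\<close>, \<open>Dmu_Ad\<close> is a linear equation for
  \<open>Ad G (U, \<phi>) (\<gamma> t) Y\<close> whose coefficient map is the identity at
  \<open>t = 0\<close>. Solving it to first order gives a difference of two mixed second
  derivatives, which is the bracket by \<open>D2mu_symmetric\<close>.\<close>

lemma Ad_has_vector_derivative:
  assumes \<gamma>: "\<gamma> 0 = \<one>" "\<forall>\<^sub>F t in at 0. \<gamma> t \<in> U"
    and X: "((\<lambda>t. \<phi> (\<gamma> t)) has_vector_derivative X) (at 0)"
  shows "((\<lambda>t. Ad G (U, \<phi>) (\<gamma> t) Y) has_vector_derivative lie_bracket G (U, \<phi>) X Y) (at 0)"
proof -
  have X': "((\<lambda>t. \<phi> (\<gamma> t)) has_derivative (\<lambda>t. t *\<^sub>R X)) (at 0)"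
    using X by (simp add: has_vector_derivative_def)
  have "((\<lambda>t. Ad G (U, \<phi>) (\<gamma> t) Y) has_vector_derivative D2\<mu> (0, Y) (X, 0) - D2\<mu> (Y, 0) (0, X)) (at 0)"
  proof (rule has_vector_derivative_eq_rhs[OF has_vector_derivative_solve_linear
      [where R = "\<lambda>t V. D\<mu> (e, \<phi> (\<gamma> t)) (V, 0)" and l = "\<lambda>t. D\<mu> (\<phi> (\<gamma> t), e) (0, Y)"
        and R' = "\<lambda>V. D2\<mu> (V, 0) (0, X)"]])
    show "\<forall>\<^sub>F t in at 0. linear (\<lambda>V. D\<mu> (e, \<phi> (\<gamma> t)) (V, 0))"
      using \<gamma>(2)
    proof eventually_elim
      case (elim t)
      show ?case
        using mu_left_has_derivative[OF elim] by (rule has_derivative_linear)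
    qed
    show "D\<mu> (e, \<phi> (\<gamma> 0)) (V, 0) = V" for V
      by (simp add: \<gamma> Dmu_one)
    show "((\<lambda>t. D\<mu> (e, \<phi> (\<gamma> t)) (V, 0)) has_vector_derivative D2\<mu> (V, 0) (0, X)) (at 0)" for V
    proof -
      have "((\<lambda>t. D\<mu> (e, \<phi> (\<gamma> t)) (V, 0)) has_derivative (\<lambda>t. D2\<mu> (V, 0) (0, t *\<^sub>R X))) (at 0)"
        by (rule has_derivative_compose[where f = "\<lambda>t. (e, \<phi> (\<gamma> t))" and g = "\<lambda>z. D\<mu> z (V, 0)",
              OF has_derivative_Pair[OF has_derivative_const X']])
          (simp add: \<gamma> Dmu_has_derivative)
      moreover have "D2\<mu> (V, 0) (0, t *\<^sub>R X) = t *\<^sub>R D2\<mu> (V, 0) (0, X)" for t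
        using linear_scale[OF linear_D2mu, of "(V, 0)" t "(0, X)"] by simp
      ultimately show ?thesis
        by (simp add: has_vector_derivative_def)
    qed
    \<comment> \<open>Symmetry moves \<open>V\<close> into the slot of the second differentiation,
      where linearity is that of a derivative.\<close>
    show "linear (\<lambda>V. D2\<mu> (V, 0) (0, X))"
      using left_invariant_field_has_derivative has_derivative_linear by (simp add: D2mu_symmetric) blast
    show "((\<lambda>t. D\<mu> (\<phi> (\<gamma> t), e) (0, Y)) has_vector_derivative D2\<mu> (0, Y) (X, 0)) (at 0)"
    proof -
      have "((\<lambda>t. D\<mu> (\<phi> (\<gamma> t), e) (0, Y)) has_derivative (\<lambda>t. D2\<mu> (0, Y) (t *\<^sub>R X, 0))) (at 0)"
        by (rule has_derivative_compose[where f = "\<lambda>t. (\<phi> (\<gamma> t), e)" and g = "\<lambda>z. D\<mu> z (0, Y)",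
              OF has_derivative_Pair[OF X' has_derivative_const]])
          (simp add: \<gamma> Dmu_has_derivative)
      moreover have "D2\<mu> (0, Y) (t *\<^sub>R X, 0) = t *\<^sub>R D2\<mu> (0, Y) (X, 0)" for t
        using linear_scale[OF linear_D2mu, of "(0, Y)" t "(X, 0)"] by simp
      ultimately show ?thesis
        by (simp add: has_vector_derivative_def)
    qed
    show "\<forall>\<^sub>F t in at 0. D\<mu> (e, \<phi> (\<gamma> t)) (Ad G (U, \<phi>) (\<gamma> t) Y, 0) = D\<mu> (\<phi> (\<gamma> t), e) (0, Y)"
      using \<gamma>(2) by eventually_elim (rule Dmu_Ad)
    show "Ad G (U, \<phi>) (\<gamma> 0) Y = D\<mu> (\<phi> (\<gamma> 0), e) (0, Y)"
      by (simp add: \<gamma> Ad_one Dmu_one)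
    show "D2\<mu> (0, Y) (X, 0) - D2\<mu> (D\<mu> (\<phi> (\<gamma> 0), e) (0, Y), 0) (0, X) = D2\<mu> (0, Y) (X, 0) - D2\<mu> (Y, 0) (0, X)"
      by (simp add: \<gamma> Dmu_one)
  qed
  then show ?thesis
    by (simp add: lie_bracket_eq D2mu_symmetric)
qed

section \<open>Infinitesimal forms of invariance under the adjoint representation\<close>

text \<open>Differentiate the invariance of \<open>Q\<close> along a curve through the identity with
  velocity \<open>X\<close>: the product rule gives the left-hand side, and a locally constant
  function has derivative 0.\<close>

lemma Ad_invariant_imp_skew:
  fixes Q :: "real ^ 'd \<Rightarrow> real ^ 'd \<Rightarrow> real"
  assumes Q: "bilinear Q"
    and inv: "\<And>g X Y. g \<in> carrier G \<Longrightarrow> Q (Ad G (U, \<phi>) g X) (Ad G (U, \<phi>) g Y) = Q X Y"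
  shows "Q (lie_bracket G (U, \<phi>) X Y) Z + Q Y (lie_bracket G (U, \<phi>) X Z) = 0"
proof -
  interpret Q: bounded_bilinear Q
    using Q by (simp add: bilinear_conv_bounded_bilinear)
  \<comment> \<open>A straight line in the chart replaces the one-parameter subgroup; only its
    velocity at 0 enters. It lies in the chart for small \<open>t\<close>.\<close>
  define \<gamma> where "\<gamma> t = \<psi> (e + t *\<^sub>R X)" for t
  have "((\<lambda>t. e + t *\<^sub>R X) \<longlongrightarrow> e) (at 0)"
    by (auto intro!: tendsto_eq_intros)
  then have ev: "\<forall>\<^sub>F t in at 0. e + t *\<^sub>R X \<in> \<phi> ` U"
    using open_chart_range e_in by (rule topological_tendstoD)
  have \<gamma>0: "\<gamma> 0 = \<one>"
    using one_in_U by (simp add: \<gamma>_def psi_phi)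
  have \<gamma>U: "\<forall>\<^sub>F t in at 0. \<gamma> t \<in> U"
    using ev by eventually_elim (simp add: \<gamma>_def psi_in)
  have "((\<lambda>t. e + t *\<^sub>R X) has_derivative (\<lambda>t. t *\<^sub>R X)) (at 0)"
    by (auto intro!: derivative_eq_intros)
  then have "((\<lambda>t. \<phi> (\<gamma> t)) has_derivative (\<lambda>t. t *\<^sub>R X)) (at 0)"
  proof (rule has_derivative_transform_eventually)
    show "\<forall>\<^sub>F t in at 0. e + t *\<^sub>R X = \<phi> (\<gamma> t)"
      using ev by eventually_elim (simp add: \<gamma>_def phi_psi)
  qed (auto simp: \<gamma>0)
  then have "((\<lambda>t. \<phi> (\<gamma> t)) has_vector_derivative X) (at 0)"
    by (simp add: has_vector_derivative_def)
  note deriv = Ad_has_vector_derivative[OF \<gamma>0 \<gamma>U this]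
  have "((\<lambda>t. Q (Ad G (U, \<phi>) (\<gamma> t) Y) (Ad G (U, \<phi>) (\<gamma> t) Z)) has_vector_derivative
      Q Y (lie_bracket G (U, \<phi>) X Z) + Q (lie_bracket G (U, \<phi>) X Y) Z) (at 0)"
    using Q.has_vector_derivative[OF deriv[of Y] deriv[of Z]] by (simp add: \<gamma>0 Ad_one)
  moreover have "((\<lambda>t. Q (Ad G (U, \<phi>) (\<gamma> t) Y) (Ad G (U, \<phi>) (\<gamma> t) Z)) has_vector_derivative 0) (at 0)"
    unfolding has_vector_derivative_def
  proof (rule has_derivative_transform_eventually)
    show "((\<lambda>t. Q Y Z) has_derivative (\<lambda>t. t *\<^sub>R 0)) (at 0)"
      by simp
    show "\<forall>\<^sub>F t in at 0. Q Y Z = Q (Ad G (U, \<phi>) (\<gamma> t) Y) (Ad G (U, \<phi>) (\<gamma> t) Z)"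
      using \<gamma>U by eventually_elim (use inv U_carrier in auto)
  qed (auto simp: \<gamma>0 Ad_one)
  ultimately show ?thesis
    using vector_derivative_unique_at by fastforce
qed

text \<open>Along a curve in \<open>H\<close> with velocity \<open>X\<close>, the difference
  quotients of \<open>Ad G (U, \<phi>) (\<gamma> t) Y\<close> stay in \<open>V\<close>. Their limit
  is the bracket, and a subspace of a finite-dimensional space is closed.\<close>

lemma subgroup_bracket_stable:
  assumes X: "X \<in> subgroup_lie_algebra G (U, \<phi>) H" and V: "subspace V" "Y \<in> V"
    and stable: "\<And>g Y. g \<in> H \<Longrightarrow> Y \<in> V \<Longrightarrow> Ad G (U, \<phi>) g Y \<in> V"
  shows "lie_bracket G (U, \<phi>) X Y \<in> V"
proof -
  obtain \<epsilon> \<gamma> where \<gamma>: "\<epsilon> > 0" "\<gamma> 0 = \<one>" "\<And>t. t \<in> {-\<epsilon><..<\<epsilon>} \<Longrightarrow> \<gamma> t \<in> H \<inter> U"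
    "((\<lambda>t. \<phi> (\<gamma> t)) has_vector_derivative X) (at (0::real))"
    using X by (auto simp: subgroup_lie_algebra_def)
  have ev: "\<forall>\<^sub>F t in at 0. \<gamma> t \<in> H \<inter> U"
    by (rule eventually_at_in_open'[THEN eventually_mono, of "{-\<epsilon><..<\<epsilon>}"]) (use \<gamma>(1,3) in auto)
  have "((\<lambda>t. Ad G (U, \<phi>) (\<gamma> t) Y) has_vector_derivative lie_bracket G (U, \<phi>) X Y) (at 0)"
    using ev by (intro Ad_has_vector_derivative \<gamma>) (auto elim: eventually_mono)
  then have "((\<lambda>t. (Ad G (U, \<phi>) (\<gamma> t) Y - Y) /\<^sub>R t) \<longlongrightarrow> lie_bracket G (U, \<phi>) X Y) (at 0)"
    by (simp add: has_vector_derivative_at_0_iff \<gamma>(2) Ad_one)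
  moreover have "\<forall>\<^sub>F t in at (0::real). (Ad G (U, \<phi>) (\<gamma> t) Y - Y) /\<^sub>R t \<in> V"
    using ev by eventually_elim (intro subspace_scale subspace_diff V stable, auto)
  ultimately show ?thesis
    by (intro Lim_in_closed_set[OF closed_subspace[OF V(1)] _ at_neq_bot])
qed

end

section \<open>Bilinear forms, traces and dual bases\<close>

lemma symmetric_bilinear_onD:
  assumes "symmetric_bilinear_on UNIV B"
  shows "B x y = B y x" "bilinear B"
proof -
  show sym: "B x y = B y x" for x y
    using assms unfolding symmetric_bilinear_on_def by blast
  have lin: "B (a *\<^sub>R x + b *\<^sub>R y) z = a * B x z + b * B y z" for a b x y z
    using assms unfolding symmetric_bilinear_on_def by blast
  have linear: "linear (\<lambda>x. B x z)" for z
    using lin[of 1 _ 1] lin[of _ _ 0] by (intro linearI) simp_all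
  have "linear (B x)" for x
  proof -
    have "B x = (\<lambda>z. B z x)"
      using sym by (rule ext)
    then show ?thesis
      using linear[of x] by (simp only:)
  qed
  with linear show "bilinear B"
    by (simp add: bilinear_def)
qed

text \<open>Expand each \<open>v i\<close> in the standard basis and exchange the sums; the inner
  sum is then the frame expansion of \<open>f (axis b 1)\<close>. The abstract index set later
  admits a disjoint union of two bases.\<close>

lemma trace_eq_dual_frame:
  fixes f :: "real ^ 'd::finite \<Rightarrow> real ^ 'd"
  assumes "linear f" and w: "\<And>i. i \<in> I \<Longrightarrow> linear (w i)"
    and frame: "\<And>x. x = (\<Sum>i\<in>I. w i x *\<^sub>R v i)"
  shows "trace (matrix f) = (\<Sum>i\<in>I. w i (f (v i)))"
proof -
  have "w i (f (v i)) = (\<Sum>b\<in>UNIV. v i $ b * w i (f (axis b 1)))" if "i \<in> I" for i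
  proof -
    interpret f: linear f by fact
    interpret w: linear "w i" using w that .
    have "v i = (\<Sum>b\<in>UNIV. v i $ b *\<^sub>R axis b 1)"
      using basis_expansion[of "v i"] by (simp add: scalar_mult_eq_scaleR)
    then have "w i (f (v i)) = w i (f (\<Sum>b\<in>UNIV. v i $ b *\<^sub>R axis b 1))"
      by simp
    then show ?thesis
      by (simp add: f.sum f.scale w.sum w.scale)
  qed
  then have "(\<Sum>i\<in>I. w i (f (v i))) = (\<Sum>i\<in>I. \<Sum>b\<in>UNIV. v i $ b * w i (f (axis b 1)))"
    by simp
  also have "\<dots> = (\<Sum>b\<in>UNIV. (\<Sum>i\<in>I. w i (f (axis b 1)) *\<^sub>R v i) $ b)"
    by (subst sum.swap) (simp add: mult.commute)
  also have "\<dots> = (\<Sum>b\<in>UNIV. f (axis b 1) $ b)"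
    using frame by metis
  finally show ?thesis
    by (simp add: trace_def matrix_def)
qed

text \<open>Pairing an expansion in \<open>E\<close> with \<open>F j\<close> isolates its
  \<open>j\<close>-th coefficient.\<close>

lemma dual_expansion:
  assumes Q: "bilinear Q" and S: "dual_bases_of S Q k E F" and x: "x \<in> S"
  shows "x = (\<Sum>i=1..k. Q x (F i) *\<^sub>R E i)"
proof -
  interpret bounded: linear "\<lambda>x. Q x y" for y
    using Q by (simp add: bilinear_def)
  have inj: "inj_on E {1..k}" and span: "span (E ` {1..k}) = S"
    and dual: "\<And>i j. i \<in> {1..k} \<Longrightarrow> j \<in> {1..k} \<Longrightarrow> Q (E i) (F j) = (if i = j then 1 else 0)"
    using S by (auto simp: dual_bases_of_def basis_of_def)
  have "x \<in> range (\<lambda>u. \<Sum>v\<in>E ` {1..k}. u v *\<^sub>R v)"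
    using x span by (simp add: span_finite)
  then obtain u where "x = (\<Sum>v\<in>E ` {1..k}. u v *\<^sub>R v)"
    by blast
  then have u: "x = (\<Sum>i=1..k. u (E i) *\<^sub>R E i)"
    using inj by (simp add: sum.reindex)
  have "Q x (F j) = u (E j)" if "j \<in> {1..k}" for j
    using that by (subst u) (simp add: bounded.sum bounded.scale dual if_distrib cong: if_cong)
  then show ?thesis
    by (subst u) simp
qed

section \<open>Reductive decompositions with an invariant form\<close>

text \<open>The interface between geometry and algebra: \<open>br_h_m\<close> and
  \<open>Q_skew\<close> are the infinitesimal forms of the invariance of \<open>\<mm>\<close> under
  \<open>Ad(H)\<close> and of \<open>Q\<close> under \<open>Ad(G)\<close>.\<close>

locale reductive_lie_algebra =
  fixes br :: "(real ^ 'd::finite) bracket" and \<hh> \<mm> :: "(real ^ 'd) set"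
    and Q ip :: "real ^ 'd \<Rightarrow> real ^ 'd \<Rightarrow> real"
  assumes bilinear_br: "bilinear br"
    and br_anticommute: "br X Y = - br Y X"
    and subspace_h: "subspace \<hh>"
    and subspace_m: "subspace \<mm>"
    and decomposition: "direct_sum \<hh> \<mm>"
    and br_h_m: "\<And>X Y. X \<in> \<hh> \<Longrightarrow> Y \<in> \<mm> \<Longrightarrow> br X Y \<in> \<mm>"
    and Q_form: "symmetric_bilinear_on UNIV Q"
    and Q_skew: "\<And>X Y Z. Q (br X Y) Z = - Q Y (br X Z)"
    and Q_orthogonal: "\<And>X Y. X \<in> \<hh> \<Longrightarrow> Y \<in> \<mm> \<Longrightarrow> Q X Y = 0"
    and Q_m: "\<And>X Y. X \<in> \<mm> \<Longrightarrow> Y \<in> \<mm> \<Longrightarrow> Q X Y = ip X Y"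
begin

abbreviation proj_m :: "real ^ 'd \<Rightarrow> real ^ 'd" where "proj_m \<equiv> component \<mm> \<hh>"
abbreviation proj_h :: "real ^ 'd \<Rightarrow> real ^ 'd" where "proj_h \<equiv> component \<hh> \<mm>"

lemma bilinear_Q: "bilinear Q"
  and Q_commute: "Q X Y = Q Y X"
  using symmetric_bilinear_onD[OF Q_form] by blast+

lemmas br_simps =
  bilinear_ladd[OF bilinear_br] bilinear_radd[OF bilinear_br]
  bilinear_lmul[OF bilinear_br] bilinear_rmul[OF bilinear_br]
  bilinear_lneg[OF bilinear_br] bilinear_rneg[OF bilinear_br]
  bilinear_lzero[OF bilinear_br] bilinear_rzero[OF bilinear_br]

lemmas Q_simps =
  bilinear_ladd[OF bilinear_Q] bilinear_radd[OF bilinear_Q]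
  bilinear_lsub[OF bilinear_Q] bilinear_rsub[OF bilinear_Q]
  bilinear_lmul[OF bilinear_Q] bilinear_rmul[OF bilinear_Q]
  bilinear_lneg[OF bilinear_Q] bilinear_rneg[OF bilinear_Q]
  bilinear_lzero[OF bilinear_Q] bilinear_rzero[OF bilinear_Q]

lemma linear_Q_left: "linear (\<lambda>X. Q X Y)"
  using bilinear_Q by (simp add: bilinear_def)

text \<open>The difference of two decompositions lies in \<open>\<hh> \<inter> \<mm>\<close>; this
  justifies the definite description in \<open>component\<close>.\<close>

lemma component_unique:
  assumes "v \<in> \<hh>" "w \<in> \<mm>" "v' \<in> \<hh>" "w' \<in> \<mm>" "v + w = v' + w'"
  shows "v = v'" "w = w'"
proof -
  have "v - v' = w' - w"
    using assms(5) by (simp add: algebra_simps)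
  then have "v - v' \<in> \<hh> \<inter> \<mm>"
    using assms subspace_diff[OF subspace_h] subspace_diff[OF subspace_m] by (metis IntI)
  then have "v - v' = 0"
    using decomposition by (metis direct_sum_def singletonD)
  then show "v = v'" "w = w'"
    using assms(5) by auto
qed

lemma component_eq:
  assumes "v \<in> \<hh>" "w \<in> \<mm>"
  shows "proj_h (v + w) = v" "proj_m (v + w) = w"
proof -
  show "proj_h (v + w) = v"
    unfolding component_def
  proof (rule the_equality)
    show "v' = v" if "v' \<in> \<hh> \<and> v + w - v' \<in> \<mm>" for v'
      using component_unique(1)[of v' "v + w - v'" v w] that assms by auto
  qed (use assms in auto)
  show "proj_m (v + w) = w"
    unfolding component_def
  proof (rule the_equality)
    show "w' = w" if "w' \<in> \<mm> \<and> v + w - w' \<in> \<hh>" for w'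
      using component_unique(2)[of "v + w - w'" w' v w] that assms by auto
  qed (use assms in auto)
qed

lemma proj_sum: "proj_h V + proj_m V = V"
  and proj_h_in: "proj_h V \<in> \<hh>"
  and proj_m_in: "proj_m V \<in> \<mm>"
proof -
  obtain v w where "v \<in> \<hh>" "w \<in> \<mm>" "V = v + w"
    using decomposition unfolding direct_sum_def by blast
  then show "proj_h V + proj_m V = V" "proj_h V \<in> \<hh>" "proj_m V \<in> \<mm>"
    by (simp_all add: component_eq)
qed

lemma proj_m_id: "V \<in> \<mm> \<Longrightarrow> proj_m V = V"
  using component_eq(2)[OF subspace_0[OF subspace_h], of V] by simp

lemma Q_proj_h: "X \<in> \<hh> \<Longrightarrow> Q X V = Q X (proj_h V)"
  by (metis Q_orthogonal Q_simps(2) add.right_neutral proj_m_in proj_sum)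

lemma Q_proj_m: "X \<in> \<mm> \<Longrightarrow> Q X V = Q X (proj_m V)"
  by (metis Q_orthogonal Q_commute Q_simps(1) add_0 proj_h_in proj_sum)

lemma Q_split: "Q V W = Q (proj_h V) (proj_h W) + Q (proj_m V) (proj_m W)"
  by (metis Q_proj_h Q_proj_m Q_simps(1) proj_h_in proj_m_in proj_sum)

lemma linear_br_br: "linear (\<lambda>V. br X (br Y V))"
  using bilinear_br linear_compose[of "br Y" "br X"] by (simp add: bilinear_def o_def)

text \<open>Invariance of \<open>Q\<close> in its associative form: the sign of
  \<open>Q_skew\<close> cancels against that of anticommutativity.\<close>

lemma br_swap: "Q (br X V) W = Q X (br V W)"
  by (simp add: br_anticommute[of X V] Q_simps Q_skew)

text \<open>The invariance of \<open>Q\<close> moves all brackets onto one side, so no Jacobi identity is needed.\<close>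

lemma Q_ricci_terms:
  assumes "X \<in> \<mm>" "Y \<in> \<mm>" "Z \<in> \<mm>"
  shows "ip (curv br \<hh> \<mm> t X Z Z) Y
    = (t - t\<^sup>2) * Q (proj_m (br X Z)) (proj_m (br Y Z)) + Q (proj_h (br X Z)) (proj_h (br Y Z))"
proof -
  let ?u = "proj_m (br X Z)" and ?h = "proj_h (br X Z)"
  have ZZ: "br Z Z = 0"
    using br_anticommute[of Z Z] by (simp add: eq_neg_iff_add_eq_0 flip: scaleR_2)
  have p0: "proj_m 0 = 0"
    using proj_m_id subspace_0[OF subspace_m] by blast
  have scale: "proj_m (t *\<^sub>R V) = t *\<^sub>R proj_m V" for V
  proof -
    have "t *\<^sub>R V = t *\<^sub>R proj_h V + t *\<^sub>R proj_m V"
      by (simp add: proj_sum flip: scaleR_right_distrib)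
    then show ?thesis
      using component_eq(2) subspace_scale[OF subspace_h proj_h_in] subspace_scale[OF subspace_m proj_m_in]
      by simp
  qed
  \<comment> \<open>The term with \<open>Lam\<close> applied to the pair \<open>Z\<close>,
    \<open>Z\<close> vanishes because \<open>br Z Z = 0\<close>; only one half of the commutator
    survives.\<close>
  have curv: "curv br \<hh> \<mm> t X Z Z
      = - (t\<^sup>2 *\<^sub>R proj_m (br Z ?u)) - t *\<^sub>R proj_m (br ?u Z) - br ?h Z"
    by (simp add: curv_def Lam_def ZZ p0 br_simps scale power2_eq_square)
  \<comment> \<open>With this the whole curvature vector lies in \<open>\<mm>\<close>, where
    \<open>ip\<close> may be replaced by \<open>Q\<close>.\<close>
  have in_m: "br ?h Z \<in> \<mm>"
    using br_h_m proj_h_in assms(3) by blast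
  then have "curv br \<hh> \<mm> t X Z Z \<in> \<mm>"
    unfolding curv by (intro subspace_diff subspace_neg subspace_scale subspace_m proj_m_in)
  then have "ip (curv br \<hh> \<mm> t X Z Z) Y = Q (curv br \<hh> \<mm> t X Z Z) Y"
    using assms Q_m by simp
  also have "\<dots> = - (t\<^sup>2 * Q (br Z ?u) Y) - t * Q (br ?u Z) Y - Q (br ?h Z) Y"
    unfolding curv using assms(2) by (simp add: Q_simps Q_proj_m[of Y, symmetric] Q_commute[of _ Y])
  \<comment> \<open>The quadratic and the linear term in \<open>t\<close> reduce to the same product
    with opposite signs, which produces the factor \<open>t - t\<^sup>2\<close>.\<close>
  also have "Q (br Z ?u) Y = Q ?u (proj_m (br Y Z))"
    using Q_proj_m[OF proj_m_in] by (simp add: Q_skew br_anticommute[of Z Y] Q_simps)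
  also have "Q (br ?u Z) Y = - Q ?u (proj_m (br Y Z))"
    using Q_proj_m[OF proj_m_in] by (simp add: br_swap br_anticommute[of Z Y] Q_simps)
  also have "Q (br ?h Z) Y = - Q ?h (proj_h (br Y Z))"
    using Q_proj_h[OF proj_h_in] by (simp add: br_swap br_anticommute[of Z Y] Q_simps)
  finally show ?thesis
    by (simp add: algebra_simps)
qed

section \<open>The forms A and beta and the Ricci tensor in adapted bases\<close>

context
  fixes n k :: nat and Z E F :: "nat \<Rightarrow> real ^ 'd"
  assumes Z: "orthonormal_basis_of \<mm> ip n Z"
    and EF: "dual_bases_of \<hh> Q k E F"
begin

lemma Z_in: "i \<in> {1..n} \<Longrightarrow> Z i \<in> \<mm>"
  using Z by (auto simp: orthonormal_basis_of_def basis_of_def intro: span_base)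

lemma E_in: "i \<in> {1..k} \<Longrightarrow> E i \<in> \<hh>" and F_in: "i \<in> {1..k} \<Longrightarrow> F i \<in> \<hh>"
  using EF span_superset[of "E ` {1..k}"] span_superset[of "F ` {1..k}"]
  unfolding dual_bases_of_def basis_of_def by blast+

lemma dual_bases_Z: "dual_bases_of \<mm> Q n Z Z"
  using Z Z_in by (auto simp: orthonormal_basis_of_def dual_bases_of_def Q_m)

lemma expansion_m: "V \<in> \<mm> \<Longrightarrow> V = (\<Sum>i=1..n. Q V (Z i) *\<^sub>R Z i)"
  by (rule dual_expansion[OF bilinear_Q dual_bases_Z])

lemma expansion_h: "V \<in> \<hh> \<Longrightarrow> V = (\<Sum>i=1..k. Q V (F i) *\<^sub>R E i)"
  by (rule dual_expansion[OF bilinear_Q EF])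

text \<open>Parseval's identity: \<open>Z\<close> is its own dual basis. The vector \<open>W\<close>
  ranges over the whole Lie algebra.\<close>

lemma Q_expansion_m:
  assumes "V \<in> \<mm>" shows "Q V W = (\<Sum>i=1..n. Q V (Z i) * Q W (Z i))"
proof -
  have "Q V W = Q (\<Sum>i=1..n. Q V (Z i) *\<^sub>R Z i) W"
    using expansion_m[OF assms] by simp
  then show ?thesis
    by (simp add: linear_sum[OF linear_Q_left] Q_simps Q_commute[of W])
qed

text \<open>Expand the first \<open>\<hh>\<close>-component in \<open>E\<close>. Pairing with an
  element of \<open>\<hh>\<close> ignores \<open>\<mm>\<close>-components, so the projections drop
  out.\<close>

lemma Q_part_expansion: "Q_part \<hh> \<mm> Q V W = (\<Sum>i=1..k. Q (F i) V * Q (E i) W)"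
proof -
  have "Q (proj_h V) (proj_h W) = Q (\<Sum>i=1..k. Q (proj_h V) (F i) *\<^sub>R E i) (proj_h W)"
    using expansion_h[OF proj_h_in, of V] by simp
  also have "\<dots> = (\<Sum>i=1..k. Q (F i) (proj_h V) * Q (E i) (proj_h W))"
    by (simp add: linear_sum[OF linear_Q_left] Q_simps Q_commute[of "proj_h V"])
  finally show ?thesis
    unfolding Q_part_def using E_in F_in by (simp add: Q_proj_h[symmetric])
qed

text \<open>The Casimir operator preserves \<open>\<mm>\<close>, so \<open>ip\<close> becomes
  \<open>Q\<close>; moving \<open>br (E i)\<close> to the other argument cancels the sign in
  \<open>casimir\<close>.\<close>

lemma A_form_eq_sum_br:
  assumes "X \<in> \<mm>" "Y \<in> \<mm>"
  shows "A_form br ip k E F X Y = (\<Sum>i=1..k. Q (br (F i) X) (br (E i) Y))"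
proof -
  have "casimir br k E F X \<in> \<mm>"
    unfolding casimir_def using assms E_in F_in
    by (intro subspace_neg subspace_sum subspace_m br_h_m) auto
  then have "A_form br ip k E F X Y = Q (casimir br k E F X) Y"
    using assms Q_m by (simp add: A_form_def)
  then show ?thesis
    by (simp add: casimir_def Q_simps linear_sum[OF linear_Q_left] Q_skew[of "E _"] sum_negf)
qed

text \<open>Expand \<open>br (F i) X\<close> in the basis \<open>Z\<close> and let
  \<open>br_swap\<close> move \<open>Z j\<close> next to \<open>X\<close> and \<open>Y\<close>. For
  fixed \<open>j\<close>, the sum over the dual bases is then \<open>Q_part\<close>.\<close>

lemma A_form_eq:
  assumes "X \<in> \<mm>" "Y \<in> \<mm>"
  shows "A_form br ip k E F X Y = (\<Sum>i=1..n. Q_part \<hh> \<mm> Q (br X (Z i)) (br Y (Z i)))"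
proof -
  have "Q (br (F i) X) (br (E i) Y) = (\<Sum>j=1..n. Q (F i) (br X (Z j)) * Q (E i) (br Y (Z j)))"
    if "i \<in> {1..k}" for i
    by (subst Q_expansion_m[OF br_h_m[OF F_in[OF that] assms(1)]]) (simp add: br_swap)
  then have "A_form br ip k E F X Y
      = (\<Sum>i=1..k. \<Sum>j=1..n. Q (F i) (br X (Z j)) * Q (E i) (br Y (Z j)))"
    using assms by (simp add: A_form_eq_sum_br)
  then show ?thesis
    by (subst (asm) sum.swap) (simp add: Q_part_expansion)
qed

text \<open>The trace is split over bases of \<open>\<mm>\<close> and \<open>\<hh>\<close>. The
  first part contributes the \<open>ip\<close> sum and one copy of \<open>A_form\<close>, the second
  part the other copy.\<close>

lemma beta_form_eq:
  assumes "X \<in> \<mm>" "Y \<in> \<mm>"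
  shows "beta_form br X Y
    = (\<Sum>i=1..n. ip (proj_m (br X (Z i))) (proj_m (br Y (Z i)))) + 2 * A_form br ip k E F X Y"
proof -
  \<comment> \<open>\<open>Z\<close> together with \<open>E\<close> is a frame of the Lie algebra,
    with \<open>Z\<close> together with \<open>F\<close> as its dual with respect to
    \<open>Q\<close>.\<close>
  let ?I = "{1..n} <+> {1..k}" and ?v = "case_sum Z E" and ?w = "case_sum Z F"
  let ?f = "\<lambda>V. br X (br Y V)"
  have "trace (matrix ?f) = (\<Sum>i\<in>?I. Q (?f (?v i)) (?w i))"
  proof (rule trace_eq_dual_frame[OF linear_br_br])
    show "linear (\<lambda>V. Q V (?w i))" for i
      by (rule linear_Q_left)
    show "V = (\<Sum>i\<in>?I. Q V (?w i) *\<^sub>R ?v i)" for V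
    proof -
      have "V = proj_h V + proj_m V"
        by (simp add: proj_sum)
      also have "proj_h V = (\<Sum>i=1..k. Q V (F i) *\<^sub>R E i)"
        using expansion_h[OF proj_h_in, of V] F_in Q_proj_h[of "F _" V] by (simp add: Q_commute)
      also have "proj_m V = (\<Sum>i=1..n. Q V (Z i) *\<^sub>R Z i)"
        using expansion_m[OF proj_m_in, of V] Z_in Q_proj_m[of "Z _" V] by (simp add: Q_commute)
      finally show ?thesis
        by (simp add: sum.Plus add.commute)
    qed
  qed
  also have "\<dots> = (\<Sum>i=1..n. Q (?f (Z i)) (Z i)) + (\<Sum>i=1..k. Q (?f (E i)) (F i))"
    by (simp add: sum.Plus)
  also have "(\<Sum>i=1..n. Q (?f (Z i)) (Z i))
      = - (\<Sum>i=1..n. ip (proj_m (br X (Z i))) (proj_m (br Y (Z i))))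
        - (\<Sum>i=1..n. Q_part \<hh> \<mm> Q (br X (Z i)) (br Y (Z i)))"
  proof -
    \<comment> \<open>Skewness of \<open>br X\<close> turns the left side into minus the product of
      \<open>br Y V\<close> and \<open>br X V\<close>, which \<open>Q_split\<close> separates into
      components.\<close>
    have "Q (?f V) V = - ip (proj_m (br X V)) (proj_m (br Y V)) - Q_part \<hh> \<mm> Q (br X V) (br Y V)" for V
      using Q_split[of "br X V" "br Y V"]
      by (simp add: Q_skew[of X] Q_part_def Q_m proj_m_in Q_commute[of "br Y V"])
    then show ?thesis
      by (simp add: sum_subtractf sum_negf)
  qed
  also have "(\<Sum>i=1..k. Q (?f (E i)) (F i)) = - A_form br ip k E F X Y"
  proof -
    \<comment> \<open>After moving \<open>br X\<close> across, both brackets are reversed; these two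
      signs cancel.\<close>
    have "Q (?f (E i)) (F i) = - Q (br (F i) X) (br (E i) Y)" for i
      unfolding Q_skew[of X] br_anticommute[of X "F i"] br_anticommute[of Y "E i"]
      by (simp add: Q_simps Q_commute[of "br (F i) X"])
    then show ?thesis
      using assms by (simp add: A_form_eq_sum_br sum_negf)
  qed
  finally show ?thesis
    using A_form_eq[OF assms] by (simp add: beta_form_def)
qed

text \<open>Summing \<open>Q_ricci_terms\<close> gives \<open>t - t\<^sup>2\<close> times the
  \<open>ip\<close> sum plus \<open>A_form\<close>. By \<open>beta_form_eq\<close> that sum is
  \<open>beta_form\<close> minus twice \<open>A_form\<close>, whence the coefficient
  \<open>1 - 2 * (t - t\<^sup>2)\<close>.\<close>

lemma Ric_eq:
  assumes "X \<in> \<mm>" "Y \<in> \<mm>"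
  shows "Ric br \<hh> \<mm> ip n Z t X Y
    = (t - t\<^sup>2) * beta_form br X Y + (2 * t\<^sup>2 - 2 * t + 1) * A_form br ip k E F X Y"
proof -
  have "Ric br \<hh> \<mm> ip n Z t X Y
      = (t - t\<^sup>2) * (\<Sum>i=1..n. ip (proj_m (br X (Z i))) (proj_m (br Y (Z i))))
        + A_form br ip k E F X Y"
    using assms Z_in
    by (simp add: Ric_def Q_ricci_terms A_form_eq Q_part_def sum.distrib sum_distrib_left Q_m proj_m_in)
  then show ?thesis
    using beta_form_eq[OF assms] by (simp add: algebra_simps)
qed

text \<open>Symmetry is visible in \<open>A_form_eq\<close>, linearity in
  \<open>A_form_eq_sum_br\<close>.\<close>

lemma symmetric_bilinear_A: "symmetric_bilinear_on \<mm> (A_form br ip k E F)"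
proof -
  have sum: "a *\<^sub>R X + b *\<^sub>R W \<in> \<mm>" if "X \<in> \<mm>" "W \<in> \<mm>" for a b X W
    using that subspace_m by (simp add: subspace_add subspace_scale)
  have "Q_part \<hh> \<mm> Q V W = Q_part \<hh> \<mm> Q W V" for V W
    by (simp add: Q_part_def Q_commute)
  moreover have "A_form br ip k E F (a *\<^sub>R X + b *\<^sub>R Y) W = a * A_form br ip k E F X W + b * A_form br ip k E F Y W"
    if "X \<in> \<mm>" "Y \<in> \<mm>" "W \<in> \<mm>" for a b X Y W
    using that sum[OF that(1,2)]
    by (simp add: A_form_eq_sum_br br_simps Q_simps sum.distrib sum_distrib_left)
  ultimately show ?thesis
    unfolding symmetric_bilinear_on_def by (auto simp: A_form_eq intro!: sum.cong)
qed

text \<open>Symmetry is inherited from the two summands in \<open>beta_form_eq\<close>; linearity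
  comes directly from the trace.\<close>

lemma symmetric_bilinear_beta: "symmetric_bilinear_on \<mm> (beta_form br)"
proof -
  have "beta_form br X Y = beta_form br Y X" if "X \<in> \<mm>" "Y \<in> \<mm>" for X Y
    using that symmetric_bilinear_A
    by (simp add: beta_form_eq symmetric_bilinear_on_def Q_m[OF proj_m_in proj_m_in, symmetric]
        Q_commute[of "proj_m (br X _)"])
  moreover have "beta_form br (a *\<^sub>R X + b *\<^sub>R Y) W = a * beta_form br X W + b * beta_form br Y W"
    for a b X Y W
    by (simp add: beta_form_def trace_def matrix_def br_simps sum.distrib sum_distrib_left)
  ultimately show ?thesis
    by (auto simp: symmetric_bilinear_on_def)
qed

end

end

section \<open>From the homogeneous space to its Lie algebra\<close>

theorem theorem4p4:
  fixes G :: "('a, 'b) monoid_scheme" and T :: "'a topology"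
    and \<A> :: "('a, 'd::finite) chart set" and c :: "('a, 'd) chart"
    and H :: "'a set" and \<hh> \<mm> :: "(real ^ 'd) set"
    and ip Q :: "real ^ 'd \<Rightarrow> real ^ 'd \<Rightarrow> real"
    and br :: "(real ^ 'd) bracket"
    and n k :: nat and Z E F :: "nat \<Rightarrow> real ^ 'd"
    and A \<beta> :: "real ^ 'd \<Rightarrow> real ^ 'd \<Rightarrow> real"
  assumes "naturally_reductive_space G T \<A> c H \<mm> ip Q"
    and "br = lie_bracket G c"
    and "\<hh> = subgroup_lie_algebra G c H"
    and "orthonormal_basis_of \<mm> ip n Z"
    and "dual_bases_of \<hh> Q k E F"
    and "A = A_form br ip k E F"
    and "\<beta> = beta_form br"
  shows "symmetric_bilinear_on \<mm> A \<and> symmetric_bilinear_on \<mm> \<beta> \<and>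
    (\<forall>X\<in>\<mm>. \<forall>Y\<in>\<mm>.
      A X Y = (\<Sum>i=1..n. Q_part \<hh> \<mm> Q (br X (Z i)) (br Y (Z i))) \<and>
      \<beta> X Y = (\<Sum>i=1..n. ip (component \<mm> \<hh> (br X (Z i))) (component \<mm> \<hh> (br Y (Z i))))
               + 2 * A X Y) \<and>
    (\<forall>t. \<forall>X\<in>\<mm>. \<forall>Y\<in>\<mm>.
      Ric br \<hh> \<mm> ip n Z t X Y = (t - t\<^sup>2) * \<beta> X Y + (2 * t\<^sup>2 - 2 * t + 1) * A X Y)"
proof -
  obtain U \<phi> where c: "c = (U, \<phi>)"
    by (cases c)
  interpret naturally_reductive_space G T \<A> c H \<mm> ip Q
    by fact
  interpret chart: lie_group_chart G T \<A> U \<phi>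
    by unfold_locales (use chart c in auto)
  have br: "br = lie_bracket G (U, \<phi>)"
    using assms(2) c by simp
  \<comment> \<open>\<open>\<hh>\<close> is defined as a set of velocities of curves; that it is a
    subspace is read off from its basis \<open>E\<close>.\<close>
  have span: "span (E ` {1..k}) = \<hh>"
    using assms(5) by (simp add: dual_bases_of_def basis_of_def)
  interpret alg: reductive_lie_algebra br \<hh> \<mm> Q ip
  proof
    show "bilinear br" "br X Y = - br Y X" for X Y
      unfolding br by (rule chart.bilinear_lie_bracket chart.lie_bracket_anticommute)+
    show "subspace \<hh>"
      unfolding span[symmetric] by (rule subspace_span)
    show "br X Y \<in> \<mm>" if "X \<in> \<hh>" "Y \<in> \<mm>" for X Y
      using chart.subgroup_bracket_stable[of X H \<mm> Y] that subspace_m Ad_m assms(3) br c by auto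
    show "Q (br X Y) Z = - Q Y (br X Z)" for X Y Z
      using chart.Ad_invariant_imp_skew[OF symmetric_bilinear_onD(2)[OF Q_form(1)], of X Y Z]
        Q_invariant br c by simp
  qed (use subspace_m decomposition Q_form Q_orthogonal Q_m assms(3) in auto)
  show ?thesis
    unfolding assms(6,7)
    using alg.symmetric_bilinear_A[OF assms(4,5)] alg.symmetric_bilinear_beta[OF assms(4,5)]
      alg.A_form_eq[OF assms(4,5)] alg.beta_form_eq[OF assms(4,5)] alg.Ric_eq[OF assms(4,5)]
    by blast
qed

end
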